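(* In a finite dynamic game as described in the context, let $K=(K^i)_{i\in\mathcal{I}}$ where, for each player $i$, $K^i$ is unilaterally sufficient information for player $i$. Then the set of payoff profiles $(J^i(\rho))_{i}$ of $K$-based sequential equilibria (sequential equilibria $(\rho,Q)$ with $\rho$ a $K$-based profile) equals the set of payoff profiles $(J^i(g))_i$ of all sequential equilibria $(g,Q)$.
   Context: Game model: finite set of players $\mathcal{I}$, times $\mathcal{T}=\{1,\dots,T\}$. At time $t$ each player $i$ takes action $U_t^i\in\mathcal{U}_t^i$, obtains reward $R_t^i\in[-1,1]$ and learns new information $Z_t^i\in\mathcal{Z}_t^i$. There is a state $X_t\in\mathcal{X}_t$ with $(X_{t+1},Z_t,R_t)=f_t(X_t,U_t,W_t)$ for fixed functions $f_t$. Primitive random variables $(X_1,H_1)$ (with $H_1=(H_1^i)_i$ initial information) and $W_1,\dots,W_T$ are mutually independent with commonly known distributions. All sets $\mathcal{X}_t,\mathcal{U}_t,\mathcal{Z}_t,\mathcal{W}_t,\mathcal{H}_1$ are finite. Perfect recall: $H_t^i=(H_1^i,Z_{1:t-1}^i)\in\mathcal{H}_t^i$, and $U_t^i$ is a component of $Z_t^i$. Behavioral strategy $g_t^i:\mathcal{H}_t^i\to\Delta(\mathcal{U}_t^i)$; payoff $J^i(g)=\mathbb{E}^g[\sum_t R_t^i]$. A realization is admissible under $g$ if it has positive probability under $g$. Sequential equilibrium (SE): for a profile $g$ and functions $Q_t^i:\mathcal{H}_t^i\times\mathcal{U}_t^i\to\mathbb{R}$: $g$ is sequentially rational under $Q$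 if $\mathrm{supp}(g_t^i(h_t^i))\subseteq\arg\max_u Q_t^i(h_t^i,u)$ for all $i,t,h_t^i$; $Q$ is fully consistent with $g$ if there is a sequence $(g^{(n)},Q^{(n)})\to(g,Q)$ with each $g^{(n)}$ fully mixed and $Q_\tau^{(n),i}(h_\tau^i,u_\tau^i)=\mathbb{E}^{g^{(n)}}[\sum_{t=\tau}^T R_t^i\mid h_\tau^i,u_\tau^i]$ for all $i,\tau,h_\tau^i,u_\tau^i$; $(g,Q)$ is an SE if both hold. Compression: $K_1^i=\iota_1^i(H_1^i)$, $K_t^i=\iota_t^i(K_{t-1}^i,Z_{t-1}^i)$ for fixed maps, finite value sets $\mathcal{K}_t^i$; $k_t^i$ is the compression of $h_t^i$; a $K^i$-based strategy has $\rho_t^i:\mathcal{K}_t^i\to\Delta(\mathcal{U}_t^i)$. Unilaterally sufficient information (USI): $K^i$ is USI for player $i$ if there exist $F_t^{i,g^i}:\mathcal{K}_t^i\to\Delta(\mathcal{H}_t^i)$ depending only on $g^i$ and $\Phi_t^{i,g^{-i}}:\mathcal{K}_t^i\to\Delta(\mathcal{X}_t\times\mathcal{H}_t^{-i})$ depending only on $g^{-i}$ with $\Pr^g(x_t,h_t\mid k_t^i)=F_t^{i,g^i}(h_t^i\mid k_t^i)\Phi_t^{i,g^{-i}}(x_t,h_t^{-i}\mid k_t^i)$ for all behavioral profiles $g$, all $t$, all $k_t^i$ admissible under $g$ (with $x_t,h_t^i,h_t^{-i}$ ranging independently; the left side is $0$ if they disagree on shared components). *)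

theory Defs
  imports "HOL-Probability.Probability"
begin

text \<open>
Finite dynamic game.  Players are the elements of the finite type 'i; times are 1..T.
The new information of player i at time t is Z_t^i = (U_t^i, Y_t^i), so that the action
U_t^i is a component of Z_t^i (perfect recall).  The dynamics
  f t x u w = (X_{t+1}, Y_t, R_t),
the joint distribution of (X_1, H_1) is init, and W_t has distribution noise t;
the primitive random variables are independent by construction of the run below.
\<close>

record ('i, 'x, 'u, 'y, 'w, 'h) game =
  horizon :: nat
  acts    :: "'i \<Rightarrow> nat \<Rightarrow> 'u set"
  dyn     :: "nat \<Rightarrow> 'x \<Rightarrow> ('i \<Rightarrow> 'u) \<Rightarrow> 'w \<Rightarrow> 'x \<times> ('i \<Rightarrow> 'y) \<times> ('i \<Rightarrow> real)"
  init    :: "('x \<times> ('i \<Rightarrow> 'h)) pmf"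
  noise   :: "nat \<Rightarrow> 'w pmf"

type_synonym ('h, 'u, 'y) hist = "'h \<times> ('u \<times> 'y) list"
  \<comment> \<open>H_t^i = (H_1^i, Z_{1:t-1}^i)\<close>

type_synonym ('i, 'h, 'u, 'y) profile = "'i \<Rightarrow> nat \<Rightarrow> ('h, 'u, 'y) hist \<Rightarrow> 'u pmf"

definition game_wf ::
  "('i::finite, 'x::finite, 'u::finite, 'y::finite, 'w::finite, 'h::finite) game \<Rightarrow> bool" where
  "game_wf G \<longleftrightarrow>
     (\<forall>i. \<forall>t\<in>{1..horizon G}. acts G i t \<noteq> {}) \<and>
     (\<forall>t\<in>{1..horizon G}. \<forall>x u w i. (\<forall>j. u j \<in> acts G j t) \<longrightarrow>
        (let (x', y, r) = dyn G t x u w in -1 \<le> r i \<and> r i \<le> 1))"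

definition hists :: "('i, 'x, 'u, 'y, 'w, 'h) game \<Rightarrow> 'i \<Rightarrow> nat \<Rightarrow> ('h, 'u, 'y) hist set" where
  "hists G i t = {(h1, zs). length zs = t - 1 \<and> (\<forall>k < t - 1. fst (zs ! k) \<in> acts G i (Suc k))}"

text \<open>Run state at time t: (X_t, H_1, (Z_1,...,Z_{t-1}), (R_1,...,R_{t-1})).\<close>
type_synonym ('i, 'x, 'u, 'y, 'h) rstate =
  "'x \<times> ('i \<Rightarrow> 'h) \<times> ('i \<Rightarrow> 'u \<times> 'y) list \<times> ('i \<Rightarrow> real) list"

definition phist :: "('i, 'x, 'u, 'y, 'h) rstate \<Rightarrow> 'i \<Rightarrow> ('h, 'u, 'y) hist" where
  "phist s i = (case s of (x, h1, zs, rs) \<Rightarrow> (h1 i, map (\<lambda>z. z i) zs))"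

definition rstate_x :: "('i, 'x, 'u, 'y, 'h) rstate \<Rightarrow> 'x" where
  "rstate_x s = fst s"

text \<open>run G g n is the distribution of the run state at time n+1 under profile g.\<close>
fun run :: "('i::finite, 'x, 'u, 'y, 'w, 'h) game \<Rightarrow> ('i, 'h, 'u, 'y) profile \<Rightarrow> nat
             \<Rightarrow> ('i, 'x, 'u, 'y, 'h) rstate pmf" where
  "run G g 0 = map_pmf (\<lambda>(x, h1). (x, h1, [], [])) (init G)"
| "run G g (Suc n) =
     bind_pmf (run G g n) (\<lambda>s.
       bind_pmf (Pi_pmf UNIV undefined (\<lambda>i. g i (Suc n) (phist s i))) (\<lambda>u.
         bind_pmf (noise G (Suc n)) (\<lambda>w.
           (case s of (x, h1, zs, rs) \<Rightarrow>
             (case dyn G (Suc n) x u w of (x', y, r) \<Rightarrow>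
               return_pmf (x', h1, zs @ [\<lambda>i. (u i, y i)], rs @ [r]))))))"

definition full_run where "full_run G g = run G g (horizon G)"

definition payoff :: "('i::finite, 'x, 'u, 'y, 'w, 'h) game \<Rightarrow> ('i, 'h, 'u, 'y) profile \<Rightarrow> 'i \<Rightarrow> real" where
  "payoff G g i = measure_pmf.expectation (full_run G g)
      (\<lambda>(x, h1, zs, rs). sum_list (map (\<lambda>r. r i) rs))"

text \<open>Elementary conditional expectation E[X | A] = E[X 1_A] / P(A) (equal to 0 when P(A) = 0).\<close>
definition cond_exp :: "'a pmf \<Rightarrow> 'a set \<Rightarrow> ('a \<Rightarrow> real) \<Rightarrow> real" where
  "cond_exp p A X = measure_pmf.expectation p (\<lambda>s. indicator A s * X s) / measure_pmf.prob p A"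

definition cond_prob :: "'a pmf \<Rightarrow> 'a set \<Rightarrow> 'a set \<Rightarrow> real" where
  "cond_prob p B A = measure_pmf.prob p (B \<inter> A) / measure_pmf.prob p A"

definition Qval :: "('i::finite, 'x, 'u, 'y, 'w, 'h) game \<Rightarrow> ('i, 'h, 'u, 'y) profile
                    \<Rightarrow> 'i \<Rightarrow> nat \<Rightarrow> ('h, 'u, 'y) hist \<Rightarrow> 'u \<Rightarrow> real" where
  "Qval G g i \<tau> h u = cond_exp (full_run G g)
      {s. (case s of (x, h1, zs, rs) \<Rightarrow>
             (h1 i, take (\<tau> - 1) (map (\<lambda>z. z i) zs)) = h \<and> fst ((zs ! (\<tau> - 1)) i) = u)}
      (\<lambda>(x, h1, zs, rs). sum_list (map (\<lambda>r. r i) (drop (\<tau> - 1) rs)))"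

definition behavioral :: "('i, 'x, 'u, 'y, 'w, 'h) game \<Rightarrow> ('i, 'h, 'u, 'y) profile \<Rightarrow> bool" where
  "behavioral G g \<longleftrightarrow>
     (\<forall>i. \<forall>t\<in>{1..horizon G}. \<forall>h\<in>hists G i t. set_pmf (g i t h) \<subseteq> acts G i t)"

definition fully_mixed :: "('i, 'x, 'u, 'y, 'w, 'h) game \<Rightarrow> ('i, 'h, 'u, 'y) profile \<Rightarrow> bool" where
  "fully_mixed G g \<longleftrightarrow>
     (\<forall>i. \<forall>t\<in>{1..horizon G}. \<forall>h\<in>hists G i t. set_pmf (g i t h) = acts G i t)"

type_synonym ('i, 'h, 'u, 'y) qfun = "'i \<Rightarrow> nat \<Rightarrow> ('h, 'u, 'y) hist \<Rightarrow> 'u \<Rightarrow> real"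

definition seq_rational ::
  "('i, 'x, 'u, 'y, 'w, 'h) game \<Rightarrow> ('i, 'h, 'u, 'y) profile \<Rightarrow> ('i, 'h, 'u, 'y) qfun \<Rightarrow> bool" where
  "seq_rational G g Q \<longleftrightarrow>
     (\<forall>i. \<forall>t\<in>{1..horizon G}. \<forall>h\<in>hists G i t.
        set_pmf (g i t h) \<subseteq> {u \<in> acts G i t. \<forall>u'\<in>acts G i t. Q i t h u' \<le> Q i t h u})"

definition fully_consistent ::
  "('i::finite, 'x, 'u, 'y, 'w, 'h) game \<Rightarrow> ('i, 'h, 'u, 'y) profile \<Rightarrow> ('i, 'h, 'u, 'y) qfun \<Rightarrow> bool" where
  "fully_consistent G g Q \<longleftrightarrow>
     (\<exists>gs :: nat \<Rightarrow> ('i, 'h, 'u, 'y) profile.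
        (\<forall>n. behavioral G (gs n) \<and> fully_mixed G (gs n)) \<and>
        (\<forall>i. \<forall>t\<in>{1..horizon G}. \<forall>h\<in>hists G i t. \<forall>u\<in>acts G i t.
            (\<lambda>n. pmf (gs n i t h) u) \<longlonglongrightarrow> pmf (g i t h) u \<and>
            (\<lambda>n. Qval G (gs n) i t h u) \<longlonglongrightarrow> Q i t h u))"

definition seq_eq ::
  "('i::finite, 'x, 'u, 'y, 'w, 'h) game \<Rightarrow> ('i, 'h, 'u, 'y) profile \<Rightarrow> ('i, 'h, 'u, 'y) qfun \<Rightarrow> bool" where
  "seq_eq G g Q \<longleftrightarrow> behavioral G g \<and> seq_rational G g Q \<and> fully_consistent G g Q"

primrec compress_aux :: "('i \<Rightarrow> 'h \<Rightarrow> 'k) \<Rightarrow> ('i \<Rightarrow> nat \<Rightarrow> 'k \<Rightarrow> 'u \<times> 'y \<Rightarrow> 'k)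
                         \<Rightarrow> 'i \<Rightarrow> nat \<Rightarrow> ('h, 'u, 'y) hist \<Rightarrow> 'k" where
  "compress_aux \<iota>1 \<iota> i 0 h = \<iota>1 i (fst h)"
| "compress_aux \<iota>1 \<iota> i (Suc n) h = \<iota> i (Suc (Suc n)) (compress_aux \<iota>1 \<iota> i n h) (snd h ! n)"

definition compress :: "('i \<Rightarrow> 'h \<Rightarrow> 'k) \<Rightarrow> ('i \<Rightarrow> nat \<Rightarrow> 'k \<Rightarrow> 'u \<times> 'y \<Rightarrow> 'k)
                         \<Rightarrow> 'i \<Rightarrow> nat \<Rightarrow> ('h, 'u, 'y) hist \<Rightarrow> 'k" where
  "compress \<iota>1 \<iota> i t h = compress_aux \<iota>1 \<iota> i (t - 1) h"

definition kbased :: "('i \<Rightarrow> 'h \<Rightarrow> 'k) \<Rightarrow> ('i \<Rightarrow> nat \<Rightarrow> 'k \<Rightarrow> 'u \<times> 'y \<Rightarrow> 'k)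
                      \<Rightarrow> ('i \<Rightarrow> nat \<Rightarrow> 'k \<Rightarrow> 'u pmf) \<Rightarrow> ('i, 'h, 'u, 'y) profile" where
  "kbased \<iota>1 \<iota> \<rho> = (\<lambda>i t h. \<rho> i t (compress \<iota>1 \<iota> i t h))"

text \<open>Unilaterally sufficient information for player i.  F depends only on g^i,
  Phi only on g^{-i}; Phi is a distribution on X_t \<times> H_t^{-i}, where an element of
  H_t^{-i} is represented by a function on players whose i-th entry is undefined.\<close>
definition USI :: "('i::finite, 'x, 'u, 'y, 'w, 'h) game \<Rightarrow> ('i \<Rightarrow> 'h \<Rightarrow> 'k)
                   \<Rightarrow> ('i \<Rightarrow> nat \<Rightarrow> 'k \<Rightarrow> 'u \<times> 'y \<Rightarrow> 'k) \<Rightarrow> 'i \<Rightarrow> bool" where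
  "USI G \<iota>1 \<iota> i \<longleftrightarrow>
    (\<exists>(F :: ('i, 'h, 'u, 'y) profile \<Rightarrow> nat \<Rightarrow> 'k \<Rightarrow> ('h, 'u, 'y) hist pmf)
      (\<Phi> :: ('i, 'h, 'u, 'y) profile \<Rightarrow> nat \<Rightarrow> 'k \<Rightarrow> ('x \<times> ('i \<Rightarrow> ('h, 'u, 'y) hist)) pmf).
       (\<forall>g g'. g i = g' i \<longrightarrow> F g = F g') \<and>
       (\<forall>g g'. (\<forall>j. j \<noteq> i \<longrightarrow> g j = g' j) \<longrightarrow> \<Phi> g = \<Phi> g') \<and>
       (\<forall>g. behavioral G g \<longrightarrow>
          (\<forall>t\<in>{1..horizon G}. \<forall>k.
             measure_pmf.prob (run G g (t - 1)) {s. compress \<iota>1 \<iota> i t (phist s i) = k} > 0 \<longrightarrow>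
             (\<forall>x (h :: 'i \<Rightarrow> ('h, 'u, 'y) hist).
                cond_prob (run G g (t - 1))
                   {s. rstate_x s = x \<and> (\<forall>j. phist s j = h j)}
                   {s. compress \<iota>1 \<iota> i t (phist s i) = k}
                = pmf (F g t k) (h i) * pmf (\<Phi> g t k) (x, h(i := undefined))))))"

end

theory Submission
  imports Defs
begin

text \<open>
Fix a sequential equilibrium (g, Q), approximated by fully mixed profiles, and a player i.  Under
USI the history of player i and the pair (state, histories of the others) are conditionally
independent given the compressed information, and the second factor is a belief that does not depend on
the strategy of player i.  Replace the strategy of player i in each approximating profile by its
conditional average given the compressed information.  This preserves, stage by stage, the joint law of
the state, the compressed information, the histories of the others and the actions; hence it preserves
all payoffs and the action values of the other players.

The action values of player i satisfy a recursion whose rewards and transition probabilities depend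
on the compressed information only.  In the limit the continuation value is a maximum by
sequential rationality, so by backward induction Q depends on the history of player i only
through its compression.  Every action in the support of a limit of the averaged strategies is used by g
at some history with the same compression, hence it is optimal, and backward induction again shows that
the new action values have the same limit Q.  So a subsequence of the averaged profiles
supports an equilibrium with the same Q in which player i is compressed; the players
are then treated one after the other.
\<close>

subsection \<open>Finitely supported distributions\<close>

lemma expectation_bind_finite:
  fixes f :: "'b \<Rightarrow> real"
  assumes "finite (set_pmf p)" "\<And>x. x \<in> set_pmf p \<Longrightarrow> finite (set_pmf (q x))"
  shows "measure_pmf.expectation (bind_pmf p q) f
       = measure_pmf.expectation p (\<lambda>x. measure_pmf.expectation (q x) f)"
proof -
  have "measure_pmf.expectation (bind_pmf p q) f
      = (\<Sum>a\<in>set_pmf p. pmf p a *\<^sub>R measure_pmf.expectation (q a) f)"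
    using assms by (intro pmf_expectation_bind) auto
  also have "\<dots> = measure_pmf.expectation p (\<lambda>x. measure_pmf.expectation (q x) f)"
    by (rule integral_measure_pmf[symmetric]) (use assms in auto)
  finally show ?thesis .
qed

lemma expectation_pair_mult_finite:
  fixes f :: "'a \<Rightarrow> real"
  assumes "finite (set_pmf p)" "finite (set_pmf q)"
  shows "measure_pmf.expectation (pair_pmf p q) (\<lambda>z. f (fst z) * g (snd z))
       = measure_pmf.expectation p f * measure_pmf.expectation q g"
  unfolding pair_pmf_def using assms
  by (simp add: expectation_bind_finite)

lemma expectation_cong_pmf:
  fixes f g :: "'a \<Rightarrow> real"
  assumes "\<And>x. x \<in> set_pmf p \<Longrightarrow> f x = g x"
  shows "measure_pmf.expectation p f = measure_pmf.expectation p g"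
  by (rule integral_cong_AE) (use assms in \<open>auto simp: AE_measure_pmf_iff\<close>)

lemma expectation_of_bool:
  "measure_pmf.expectation p (\<lambda>x. of_bool (P x)) = measure_pmf.prob p {x. P x}"
proof -
  have "measure_pmf.expectation p (\<lambda>x. of_bool (P x)) = measure_pmf.expectation p (indicator {x. P x} :: _ \<Rightarrow> real)"
    by (intro arg_cong[where f="measure_pmf.expectation p"] ext) (simp add: indicator_def)
  then show ?thesis by simp
qed

text \<open>Agreement on the support of \<open>p\<close> already uses up the unit mass of
  \<open>q\<close>, so \<open>q\<close> vanishes elsewhere.\<close>

lemma pmf_eqI_on_support:
  assumes "finite (set_pmf p)" "\<And>x. x \<in> set_pmf p \<Longrightarrow> pmf p x = pmf q x"
  shows "p = q"
proof -
  have "measure_pmf.prob q (set_pmf p) = sum (pmf p) (set_pmf p)"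
    using assms by (simp add: measure_measure_pmf_finite)
  also have "\<dots> = 1" using sum_pmf_eq_1[OF assms(1) order_refl] .
  finally have "set_pmf q \<subseteq> set_pmf p"
    by (metis AE_measure_pmf_iff measure_pmf.prob_eq_1 sets_measure_pmf UNIV_I subsetI)
  then show ?thesis
    using assms(2) by (intro pmf_eqI) (metis pmf_eq_0_set_pmf subsetD)
qed

text \<open>Disintegration of \<open>p\<close> along the fibres of \<open>f\<close>; with
  \<open>f\<close> the compression map it allows laws to be compared fibre by fibre.\<close>

lemma bind_cond_pmf_fibre:
  "bind_pmf (map_pmf f p) (\<lambda>k. cond_pmf p {s. f s = k}) = p"
proof -
  have "bind_pmf (map_pmf f p) (\<lambda>k. cond_pmf p {s. k = f s}) = p"
    by (rule bind_cond_pmf_cancel) (auto simp: vimage_def eq_commute)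
  moreover have "{s. k = f s} = {s. f s = k}" for k by auto
  ultimately show ?thesis by simp
qed

section \<open>Limits and compactness of distributions\<close>

lemma tendsto_expectation:
  fixes f :: "nat \<Rightarrow> 'a \<Rightarrow> real"
  assumes "finite S" "\<And>n. set_pmf (p n) \<subseteq> S" "set_pmf q \<subseteq> S"
    and "\<And>s. s \<in> S \<Longrightarrow> (\<lambda>n. pmf (p n) s) \<longlonglongrightarrow> pmf q s"
    and "\<And>s. s \<in> S \<Longrightarrow> (\<lambda>n. f n s) \<longlonglongrightarrow> f' s"
  shows "(\<lambda>n. measure_pmf.expectation (p n) (f n)) \<longlonglongrightarrow> measure_pmf.expectation q f'"
proof -
  have "measure_pmf.expectation (p n) (f n) = (\<Sum>s\<in>S. f n s * pmf (p n) s)" for n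
    using assms(1,2) by (intro integral_measure_pmf_real) auto
  moreover have "measure_pmf.expectation q f' = (\<Sum>s\<in>S. f' s * pmf q s)"
    using assms(1,3) by (intro integral_measure_pmf_real) auto
  ultimately show ?thesis
    using assms(4,5) by (auto intro!: tendsto_sum tendsto_mult)
qed

text \<open>Compactness of the probability simplex: Bolzano-Weierstrass in \<open>real ^ 'a\<close>,
  where nonnegativity and total mass 1 pass to the limit.\<close>

lemma pmf_convergent_subsequence:
  fixes p :: "nat \<Rightarrow> 'a::finite pmf"
  shows "\<exists>r q. strict_mono r \<and> (\<forall>a. (\<lambda>n. pmf (p (r n)) a) \<longlonglongrightarrow> pmf q a)"
proof -
  let ?v = "\<lambda>n. (\<chi> a. pmf (p n) a) :: real ^ 'a"
  have "norm (?v n) \<le> 1" for n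
  proof -
    have "norm (?v n) \<le> (\<Sum>a\<in>UNIV. \<bar>?v n $ a\<bar>)" by (rule norm_le_l1_cart)
    also have "\<dots> = 1" by (simp add: sum_pmf_eq_1)
    finally show ?thesis .
  qed
  then have "bounded (range ?v)" by (auto simp: bounded_iff)
  then obtain l r where r: "strict_mono r" and l: "(?v \<circ> r) \<longlonglongrightarrow> l"
    using bounded_imp_convergent_subsequence by blast
  have lim: "(\<lambda>n. pmf (p (r n)) a) \<longlonglongrightarrow> l $ a" for a
    using tendsto_vec_nth[OF l, of a] by (simp add: o_def)
  have nonneg: "l $ a \<ge> 0" for a
    by (rule LIMSEQ_le_const[OF lim]) auto
  have "(\<lambda>n. \<Sum>a\<in>UNIV. pmf (p (r n)) a) \<longlonglongrightarrow> (\<Sum>a\<in>UNIV. l $ a)"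
    by (intro tendsto_sum lim)
  then have "(\<Sum>a\<in>UNIV. l $ a) = 1"
    by (simp add: sum_pmf_eq_1 LIMSEQ_const_iff)
  then have "(\<integral>\<^sup>+ a. ennreal (l $ a) \<partial>count_space UNIV) = 1"
    by (simp add: nn_integral_count_space_finite sum_ennreal nonneg)
  then have "pmf (embed_pmf (($) l)) a = l $ a" for a
    using nonneg by (intro pmf_embed_pmf) auto
  then show ?thesis using r lim by metis
qed

text \<open>Successive extraction, one index at a time; a further subsequence keeps the limits
  already obtained.\<close>

lemma pmf_convergent_subsequence_finite:
  fixes p :: "nat \<Rightarrow> 'b \<Rightarrow> 'a::finite pmf"
  assumes "finite I"
  shows "\<exists>r q. strict_mono r \<and> (\<forall>i\<in>I. \<forall>a. (\<lambda>n. pmf (p (r n) i) a) \<longlonglongrightarrow> pmf (q i) a)"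
  using assms
proof induction
  case empty
  then show ?case using strict_mono_id by blast
next
  case (insert i I)
  then obtain r q where r: "strict_mono r"
    and q: "\<forall>i\<in>I. \<forall>a. (\<lambda>n. pmf (p (r n) i) a) \<longlonglongrightarrow> pmf (q i) a" by blast
  obtain r' q' where r': "strict_mono r'"
    and q': "\<forall>a. (\<lambda>n. pmf (p (r (r' n)) i) a) \<longlonglongrightarrow> pmf q' a"
    using pmf_convergent_subsequence[of "\<lambda>n. p (r n) i"] by blast
  have "(\<lambda>n. pmf (p (r (r' n)) j) a) \<longlonglongrightarrow> pmf ((q(i := q')) j) a" if "j \<in> insert i I" for j a
  proof (cases "j = i")
    case False
    then show ?thesis using LIMSEQ_subseq_LIMSEQ[OF _ r', of "\<lambda>n. pmf (p (r n) j) a"] q that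
      by (auto simp: o_def)
  qed (use q' in auto)
  then show ?case
    using strict_mono_o[OF r r'] by (intro exI[of _ "r \<circ> r'"] exI[of _ "q(i := q')"]) (auto simp: o_def)
qed

subsection \<open>The run as a Markov chain on states and histories\<close>

definition outcome :: "('i, 'x, 'u, 'y, 'w, 'h) game \<Rightarrow> nat \<Rightarrow> 'x \<Rightarrow> ('i \<Rightarrow> 'u)
    \<Rightarrow> ('x \<times> ('i \<Rightarrow> 'y) \<times> ('i \<Rightarrow> real)) pmf" where
  "outcome G t x u = map_pmf (dyn G t x u) (noise G t)"

definition joint_act :: "('i::finite, 'h, 'u, 'y) profile \<Rightarrow> nat \<Rightarrow> ('i \<Rightarrow> ('h, 'u, 'y) hist)
    \<Rightarrow> ('i \<Rightarrow> 'u) pmf" where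
  "joint_act g t h = Pi_pmf UNIV undefined (\<lambda>i. g i t (h i))"

definition extend :: "('h, 'u, 'y) hist \<Rightarrow> 'u \<times> 'y \<Rightarrow> ('h, 'u, 'y) hist" where
  "extend h z = (fst h, snd h @ [z])"

text \<open>The initial law \<open>p\<close> is a parameter because \<open>mrun\<close> recurses
  through this kernel, and \<open>stage\<close> is obtained from \<open>mrun\<close> only
  afterwards.\<close>

definition stage_of :: "('i::finite, 'x, 'u, 'y, 'w, 'h) game \<Rightarrow> ('i, 'h, 'u, 'y) profile \<Rightarrow> nat
    \<Rightarrow> ('x \<times> ('i \<Rightarrow> ('h, 'u, 'y) hist)) pmf
    \<Rightarrow> ('x \<times> ('i \<Rightarrow> ('h, 'u, 'y) hist) \<times> ('i \<Rightarrow> 'u) \<times> 'x \<times> ('i \<Rightarrow> 'y) \<times> ('i \<Rightarrow> real)) pmf" where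
  "stage_of G g n p = bind_pmf p (\<lambda>(x, h). bind_pmf (joint_act g (Suc n) h)
     (\<lambda>u. map_pmf (\<lambda>z. (x, h, u, z)) (outcome G (Suc n) x u)))"

text \<open>
Times are shifted by one: \<open>mrun G g n\<close> is the law of (X_{n+1}, H_{n+1}), and \<open>stage G g n\<close> that of
(X_{n+1}, H_{n+1}, U_{n+1}, X_{n+2}, Y_{n+1}, R_{n+1}).
\<close>

primrec mrun :: "('i::finite, 'x, 'u, 'y, 'w, 'h) game \<Rightarrow> ('i, 'h, 'u, 'y) profile \<Rightarrow> nat
    \<Rightarrow> ('x \<times> ('i \<Rightarrow> ('h, 'u, 'y) hist)) pmf" where
  "mrun G g 0 = map_pmf (\<lambda>(x, h1). (x, \<lambda>i. (h1 i, []))) (init G)"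
| "mrun G g (Suc n) = map_pmf (\<lambda>(x, h, u, x', y, r). (x', \<lambda>i. extend (h i) (u i, y i)))
     (stage_of G g n (mrun G g n))"

definition "stage G g n = stage_of G g n (mrun G g n)"

lemma finite_outcome [simp]: "finite (set_pmf (outcome G t x u))"
  for G :: "('i, 'x, 'u, 'y, 'w::finite, 'h) game"
  by (simp add: outcome_def)

lemma finite_stage_of:
  fixes G :: "('i::finite, 'x, 'u::finite, 'y, 'w::finite, 'h) game"
  assumes "finite (set_pmf p)"
  shows "finite (set_pmf (stage_of G g n p))"
  using assms by (auto simp: stage_of_def)

lemma finite_mrun [simp]:
  fixes G :: "('i::finite, 'x::finite, 'u::finite, 'y, 'w::finite, 'h::finite) game"
  shows "finite (set_pmf (mrun G g n))"
  by (induction n) (auto intro: finite_stage_of)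

lemma finite_stage [simp]:
  fixes G :: "('i::finite, 'x::finite, 'u::finite, 'y, 'w::finite, 'h::finite) game"
  shows "finite (set_pmf (stage G g n))"
  by (simp add: stage_def finite_stage_of)

lemma stage_map:
  "map_pmf f (stage G g n) = bind_pmf (mrun G g n) (\<lambda>(x, h). bind_pmf (joint_act g (Suc n) h)
     (\<lambda>u. map_pmf (\<lambda>z. f (x, h, u, z)) (outcome G (Suc n) x u)))"
  by (simp add: stage_def stage_of_def map_bind_pmf case_prod_beta' pmf.map_comp o_def)

lemma run_Suc_outcome:
  "run G g (Suc n) = bind_pmf (run G g n) (\<lambda>s. bind_pmf (joint_act g (Suc n) (phist s))
     (\<lambda>u. map_pmf (\<lambda>(x', y, r). (x', fst (snd s), fst (snd (snd s)) @ [\<lambda>i. (u i, y i)],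
        snd (snd (snd s)) @ [r])) (outcome G (Suc n) (rstate_x s) u)))"
  by (simp add: joint_act_def outcome_def rstate_x_def map_pmf_def bind_assoc_pmf
      bind_return_pmf case_prod_beta')

lemma length_run:
  assumes "s \<in> set_pmf (run G g n)"
  shows "length (fst (snd (snd s))) = n \<and> length (snd (snd (snd s))) = n"
  using assms
proof (induction n arbitrary: s)
  case (Suc n)
  then show ?case unfolding run_Suc_outcome by fastforce
qed auto

lemma phist_append:
  "phist (x, fst (snd s), fst (snd (snd s)) @ [\<lambda>i. (u i, y i)], rs) = (\<lambda>i. extend (phist s i) (u i, y i))"
  by (simp add: phist_def extend_def fun_eq_iff case_prod_beta')

text \<open>Strategies and dynamics read a run state only through its state component and the
  players' histories, so this projection is itself a Markov chain.\<close>

lemma run_eq_mrun: "map_pmf (\<lambda>s. (rstate_x s, phist s)) (run G g n) = mrun G g n"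
proof (induction n)
  case 0
  then show ?case
    by (simp add: pmf.map_comp o_def case_prod_beta' rstate_x_def phist_def)
next
  case (Suc n)
  have "mrun G g (Suc n) = bind_pmf (run G g n) (\<lambda>s. bind_pmf (joint_act g (Suc n) (phist s))
     (\<lambda>u. map_pmf (\<lambda>(x', y, r). (x', \<lambda>i. extend (phist s i) (u i, y i))) (outcome G (Suc n) (rstate_x s) u)))"
    unfolding mrun.simps stage_def[symmetric] unfolding stage_map unfolding Suc[symmetric]
    by (simp add: bind_map_pmf case_prod_beta')
  also have "\<dots> = map_pmf (\<lambda>s. (rstate_x s, phist s)) (run G g (Suc n))"
    unfolding run_Suc_outcome
    by (simp add: map_bind_pmf pmf.map_comp o_def case_prod_beta' rstate_x_def phist_append)
  finally show ?case by simp
qed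

text \<open>Later stages only append to the lists, so the first \<open>Suc n\<close> observations
  and the reward with index \<open>n\<close> keep the joint law they had at the end of their own
  stage.\<close>

lemma run_prefix:
  fixes G :: "('i::finite, 'x, 'u, 'y, 'w, 'h) game"
  assumes "n < N"
  shows "map_pmf (\<lambda>(x, h1, zs, rs). (\<lambda>i. (h1 i, map (\<lambda>z. z i) (take (Suc n) zs)), rs ! n)) (run G g N)
       = map_pmf (\<lambda>(x, h, u, x', y, r). (\<lambda>i. extend (h i) (u i, y i), r)) (stage G g n)"
  using assms
proof (induction N)
  case (Suc N)
  let ?f = "\<lambda>s::('i, 'x, 'u, 'y, 'h) rstate.
     (\<lambda>i. (fst (snd s) i, map (\<lambda>z. z i) (take (Suc n) (fst (snd (snd s))))), snd (snd (snd s)) ! n)"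
  have f: "(\<lambda>(x, h1, zs, rs). (\<lambda>i. (h1 i, map (\<lambda>z. z i) (take (Suc n) zs)), rs ! n)) = ?f"
    by auto
  show ?case
  proof (cases "n < N")
    case True
    \<comment> \<open>The lists already have length \<open>N > n\<close>, so the last stage touches
      neither component of \<open>?f\<close>.\<close>
    have "map_pmf ?f (run G g (Suc N)) = bind_pmf (run G g N) (\<lambda>s. return_pmf (?f s))"
      unfolding run_Suc_outcome map_bind_pmf
    proof (rule bind_pmf_cong[OF refl], goal_cases)
      case (1 s)
      then show ?case using length_run[OF 1] True
        by (simp add: pmf.map_comp o_def case_prod_beta' nth_append)
    qed
    then show ?thesis using Suc.IH True f by (simp add: map_pmf_def)
  next
    case False
    then have n: "n = N" using Suc.prems by simp
    have "map_pmf ?f (run G g (Suc N)) = bind_pmf (run G g N) (\<lambda>s. bind_pmf (joint_act g (Suc N) (phist s))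
      (\<lambda>u. map_pmf (\<lambda>z. (\<lambda>i. extend (phist s i) (u i, fst (snd z) i), snd (snd z))) (outcome G (Suc n) (rstate_x s) u)))"
      unfolding run_Suc_outcome map_bind_pmf
    proof (intro bind_pmf_cong[OF refl], goal_cases)
      case (1 s)
      then show ?case using length_run[OF 1(1)]
        by (simp add: pmf.map_comp o_def case_prod_beta' nth_append n phist_def extend_def)
    qed
    also have "\<dots> = map_pmf (\<lambda>(x, h, u, x', y, r). (\<lambda>i. extend (h i) (u i, y i), r)) (stage G g n)"
      by (simp add: stage_map run_eq_mrun[symmetric] bind_map_pmf case_prod_beta' n)
    finally show ?thesis using f by simp
  qed
qed simp

text \<open>
The average strategy changes the joint law of the rewards of different stages, so payoffs and
action values have to be split into sums over single stages.
\<close>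

definition stage_reward :: "('i::finite, 'x, 'u, 'y, 'w, 'h) game \<Rightarrow> ('i, 'h, 'u, 'y) profile \<Rightarrow> 'i \<Rightarrow> nat
    \<Rightarrow> (('i \<Rightarrow> ('h, 'u, 'y) hist) \<Rightarrow> real) \<Rightarrow> real" where
  "stage_reward G g j m f = measure_pmf.expectation (stage G g m)
     (\<lambda>(x, h, u, x', y, r). f (\<lambda>i. extend (h i) (u i, y i)) * r j)"

section \<open>Action values as quotients of sums over stages\<close>

definition played :: "nat \<Rightarrow> ('h, 'u, 'y) hist \<Rightarrow> 'u \<Rightarrow> ('h, 'u, 'y) hist \<Rightarrow> bool" where
  "played n h a h' \<longleftrightarrow> (fst h', take n (snd h')) = h \<and> fst (snd h' ! n) = a"

text \<open>Numerator of the conditional expectation \<open>Qval\<close> at time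
  \<open>Suc n\<close>. Unlike the quotient it is additive over stages.\<close>

definition Qnum :: "('i::finite, 'x, 'u, 'y, 'w, 'h) game \<Rightarrow> ('i, 'h, 'u, 'y) profile \<Rightarrow> 'i \<Rightarrow> nat
    \<Rightarrow> ('h, 'u, 'y) hist \<Rightarrow> 'u \<Rightarrow> real" where
  "Qnum G g i n h a = measure_pmf.expectation (full_run G g)
     (\<lambda>s. of_bool (played n h a (phist s i)) * sum_list (map (\<lambda>r. r i) (drop n (snd (snd (snd s))))))"

definition Qden :: "('i::finite, 'x, 'u, 'y, 'w, 'h) game \<Rightarrow> ('i, 'h, 'u, 'y) profile \<Rightarrow> 'i \<Rightarrow> nat
    \<Rightarrow> ('h, 'u, 'y) hist \<Rightarrow> 'u \<Rightarrow> real" where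
  "Qden G g i n h a = measure_pmf.prob (full_run G g) {s. played n h a (phist s i)}"

lemma finite_run [simp]:
  fixes G :: "('i::finite, 'x::finite, 'u::finite, 'y, 'w::finite, 'h::finite) game"
  shows "finite (set_pmf (run G g n))"
proof (induction n)
  case (Suc n)
  then show ?case unfolding run_Suc_outcome by simp
qed simp

lemma Qval_eq:
  fixes G :: "('i::finite, 'x::finite, 'u::finite, 'y, 'w::finite, 'h::finite) game"
  assumes "n < horizon G"
  shows "Qval G g i (Suc n) h a = Qnum G g i n h a / Qden G g i n h a"
proof -
  \<comment> \<open>The event in \<open>Qval\<close> indexes \<open>zs\<close> before projecting to
    player \<open>i\<close>, \<open>played\<close> indexes after it; the two agree only for
    \<open>n < length zs\<close>, which holds on the support.\<close>
  have ev: "(case s of (x, h1, zs, rs) \<Rightarrow>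
      (h1 i, take (Suc n - 1) (map (\<lambda>z. z i) zs)) = h \<and> fst ((zs ! (Suc n - 1)) i) = a)
     \<longleftrightarrow> played n h a (phist s i)" if "s \<in> set_pmf (full_run G g)" for s
    using length_run[of s G g "horizon G"] that assms
    by (auto simp: full_run_def played_def phist_def)
  show ?thesis
    unfolding Qval_def cond_exp_def Qnum_def Qden_def
  proof (intro arg_cong2[where f="(/)"] expectation_cong_pmf, goal_cases)
    case (1 s)
    then show ?case using ev[OF 1] by (auto simp: case_prod_beta' indicator_def)
  next
    case 2
    show ?case using ev by (intro measure_pmf.finite_measure_eq_AE) (auto simp: AE_measure_pmf_iff)
  qed
qed

lemma expectation_run_stage:
  fixes f :: "('i::finite \<Rightarrow> ('h::finite, 'u::finite, 'y) hist) \<Rightarrow> ('i \<Rightarrow> real) \<Rightarrow> real"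
  assumes "n < N"
  shows "measure_pmf.expectation (run G g N)
      (\<lambda>s. f (\<lambda>i. (fst (phist s i), take (Suc n) (snd (phist s i)))) (snd (snd (snd s)) ! n))
    = measure_pmf.expectation (stage G g n)
      (\<lambda>(x, h, u, x', y, r). f (\<lambda>i. extend (h i) (u i, y i)) r)"
proof -
  have "measure_pmf.expectation (map_pmf (\<lambda>(x, h1, zs, rs). (\<lambda>i. (h1 i, map (\<lambda>z. z i) (take (Suc n) zs)), rs ! n))
          (run G g N)) (\<lambda>(h, r). f h r)
      = measure_pmf.expectation (map_pmf (\<lambda>(x, h, u, x', y, r). (\<lambda>i. extend (h i) (u i, y i), r)) (stage G g n)) (\<lambda>(h, r). f h r)"
    by (simp add: run_prefix[OF assms])
  then show ?thesis
    by (simp add: case_prod_beta' phist_def take_map)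
qed

lemma sum_list_drop_nth:
  assumes "n \<le> length rs"
  shows "sum_list (map f (drop n rs)) = (\<Sum>m\<in>{n..<length rs}. f (rs ! m))"
proof -
  have "sum_list (map f (drop n rs)) = (\<Sum>i<length rs - n. f (rs ! (n + i)))"
    by (simp add: sum_list_sum_nth atLeast0LessThan)
  also have "\<dots> = (\<Sum>m\<in>{n..<length rs}. f (rs ! m))"
    using assms by (intro sum.reindex_bij_witness[of _ "\<lambda>m. m - n" "\<lambda>i. n + i"]) auto
  finally show ?thesis .
qed

lemma played_take:
  assumes "n \<le> m"
  shows "played n h a (fst h', take (Suc m) (snd h')) = played n h a h'"
  using assms by (auto simp: played_def min_def)

text \<open>The event \<open>played n h a\<close> is decided by the first \<open>Suc n\<close>
  entries, so for every \<open>m \<ge> n\<close> it can be evaluated on the histories at the end of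
  stage \<open>m\<close>.\<close>

lemma Qnum_eq_stage_reward:
  fixes G :: "('i::finite, 'x::finite, 'u::finite, 'y, 'w::finite, 'h::finite) game"
  assumes "n < horizon G"
  shows "Qnum G g i n h a
    = (\<Sum>m\<in>{n..<horizon G}. stage_reward G g i m (\<lambda>hh. of_bool (played n h a (hh i))))"
proof -
  have "Qnum G g i n h a = measure_pmf.expectation (run G g (horizon G))
     (\<lambda>s. \<Sum>m\<in>{n..<horizon G}. of_bool (played n h a (phist s i)) * (snd (snd (snd s)) ! m) i)"
    unfolding Qnum_def full_run_def
  proof (rule expectation_cong_pmf, goal_cases)
    case (1 s)
    then show ?case using length_run[OF 1] assms
      by (simp add: sum_list_drop_nth sum_distrib_left)
  qed
  also have "\<dots> = (\<Sum>m\<in>{n..<horizon G}. measure_pmf.expectation (run G g (horizon G))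
     (\<lambda>s. of_bool (played n h a (phist s i)) * (snd (snd (snd s)) ! m) i))"
    by (rule Bochner_Integration.integral_sum) (simp add: integrable_measure_pmf_finite)
  also have "\<dots> = (\<Sum>m\<in>{n..<horizon G}. stage_reward G g i m (\<lambda>hh. of_bool (played n h a (hh i))))"
  proof (rule sum.cong[OF refl], goal_cases)
    case (1 m)
    then show ?case
      using expectation_run_stage[of m "horizon G" G g "\<lambda>hh r. of_bool (played n h a (hh i)) * r i"]
      by (simp add: stage_reward_def played_take)
  qed
  finally show ?thesis .
qed

lemma Qden_eq:
  fixes G :: "('i::finite, 'x::finite, 'u::finite, 'y, 'w::finite, 'h::finite) game"
  assumes "n < horizon G"
  shows "Qden G g i n h a = measure_pmf.expectation (stage G g n)
      (\<lambda>(x, h', u, x', y, r). of_bool (played n h a (extend (h' i) (u i, y i))))"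
  using expectation_run_stage[OF assms, of G g "\<lambda>hh r. of_bool (played n h a (hh i))"]
  by (simp add: Qden_def full_run_def expectation_of_bool played_take)

lemma payoff_eq_stage_reward:
  fixes G :: "('i::finite, 'x::finite, 'u::finite, 'y, 'w::finite, 'h::finite) game"
  shows "payoff G g i = (\<Sum>m\<in>{..<horizon G}. stage_reward G g i m (\<lambda>_. 1))"
proof -
  have "payoff G g i = measure_pmf.expectation (run G g (horizon G))
     (\<lambda>s. \<Sum>m\<in>{..<horizon G}. (snd (snd (snd s)) ! m) i)"
    unfolding payoff_def full_run_def
  proof (rule expectation_cong_pmf, goal_cases)
    case (1 s)
    then show ?case using length_run[OF 1] sum_list_drop_nth[of 0 "snd (snd (snd s))" "\<lambda>r. r i"]
      by (simp add: case_prod_beta' atLeast0LessThan)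
  qed
  also have "\<dots> = (\<Sum>m\<in>{..<horizon G}. measure_pmf.expectation (run G g (horizon G))
     (\<lambda>s. (snd (snd (snd s)) ! m) i))"
    by (rule Bochner_Integration.integral_sum) (simp add: integrable_measure_pmf_finite)
  also have "\<dots> = (\<Sum>m\<in>{..<horizon G}. stage_reward G g i m (\<lambda>_. 1))"
  proof (rule sum.cong[OF refl], goal_cases)
    case (1 m)
    then show ?case
      using expectation_run_stage[of m "horizon G" G g "\<lambda>hh r. r i"]
      by (simp add: stage_reward_def)
  qed
  finally show ?thesis .
qed

text \<open>On a null event the integrand vanishes on the support. This keeps the identity numerator
  = denominator * value true where the quotient is a division by zero.\<close>

lemma Qnum_zero:
  assumes "Qden G g i n h a = 0"
  shows "Qnum G g i n h a = 0"
proof -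
  have "set_pmf (full_run G g) \<inter> {s. played n h a (phist s i)} = {}"
    using assms unfolding Qden_def by (simp add: measure_pmf_zero_iff)
  then have "Qnum G g i n h a = measure_pmf.expectation (full_run G g) (\<lambda>_. 0)"
    unfolding Qnum_def by (intro expectation_cong_pmf) auto
  then show ?thesis by simp
qed

subsection \<open>Beliefs under unilaterally sufficient information\<close>

abbreviation info_is :: "('i \<Rightarrow> 'h \<Rightarrow> 'k) \<Rightarrow> ('i \<Rightarrow> nat \<Rightarrow> 'k \<Rightarrow> 'u \<times> 'y \<Rightarrow> 'k) \<Rightarrow> 'i \<Rightarrow> nat \<Rightarrow> 'k
    \<Rightarrow> ('x \<times> ('i \<Rightarrow> ('h, 'u, 'y) hist)) set" where
  "info_is \<iota>1 \<iota> i n k \<equiv> {s. compress \<iota>1 \<iota> i (Suc n) (snd s i) = k}"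

text \<open>
The factor F of USI is necessarily the conditional law of the history of player i, which leaves \<open>\<Phi>\<close>
as the only unknown.
\<close>

definition belief_map :: "('i::finite, 'x, 'u, 'y, 'w, 'h) game \<Rightarrow> ('i \<Rightarrow> 'h \<Rightarrow> 'k)
    \<Rightarrow> ('i \<Rightarrow> nat \<Rightarrow> 'k \<Rightarrow> 'u \<times> 'y \<Rightarrow> 'k) \<Rightarrow> 'i
    \<Rightarrow> (('i, 'h, 'u, 'y) profile \<Rightarrow> nat \<Rightarrow> 'k \<Rightarrow> ('x \<times> ('i \<Rightarrow> ('h, 'u, 'y) hist)) pmf) \<Rightarrow> bool" where
  "belief_map G \<iota>1 \<iota> i \<Phi> \<longleftrightarrow>
     (\<forall>g g'. (\<forall>j. j \<noteq> i \<longrightarrow> g j = g' j) \<longrightarrow> \<Phi> g = \<Phi> g') \<and>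
     (\<forall>g n k. behavioral G g \<longrightarrow> n < horizon G \<longrightarrow> set_pmf (mrun G g n) \<inter> info_is \<iota>1 \<iota> i n k \<noteq> {} \<longrightarrow>
        (let C = cond_pmf (mrun G g n) (info_is \<iota>1 \<iota> i n k) in
          map_pmf (\<lambda>(x, h). (h i, x, h(i := undefined))) C
            = pair_pmf (map_pmf (\<lambda>(x, h). h i) C) (\<Phi> g n k)))"

lemma belief_mapD:
  assumes "belief_map G \<iota>1 \<iota> i \<Phi>" "behavioral G g" "n < horizon G"
    "set_pmf (mrun G g n) \<inter> info_is \<iota>1 \<iota> i n k \<noteq> {}"
  shows "map_pmf (\<lambda>(x, h). (h i, x, h(i := undefined))) (cond_pmf (mrun G g n) (info_is \<iota>1 \<iota> i n k))
    = pair_pmf (map_pmf (\<lambda>(x, h). h i) (cond_pmf (mrun G g n) (info_is \<iota>1 \<iota> i n k))) (\<Phi> g n k)"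
  using assms by (simp add: belief_map_def Let_def)

text \<open>The map \<open>?e\<close> separates the own history from the rest injectively, so the
  USI equation for point masses becomes a product form of a law. Its first marginal then identifies
  \<open>F\<close>.\<close>

lemma USI_belief_map:
  fixes G :: "('i::finite, 'x::finite, 'u::finite, 'y, 'w::finite, 'h::finite) game"
  assumes "USI G \<iota>1 \<iota> i"
  obtains \<Phi> where "belief_map G \<iota>1 \<iota> i \<Phi>"
proof -
  obtain F \<Phi> where
    dep: "\<forall>g g'. (\<forall>j. j \<noteq> i \<longrightarrow> g j = g' j) \<longrightarrow> \<Phi> g = \<Phi> g'" and
    all: "\<forall>g. behavioral G g \<longrightarrow> (\<forall>t\<in>{1..horizon G}. \<forall>k.
       measure_pmf.prob (run G g (t - 1)) {s. compress \<iota>1 \<iota> i t (phist s i) = k} > 0 \<longrightarrow>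
       (\<forall>x h. cond_prob (run G g (t - 1)) {s. rstate_x s = x \<and> (\<forall>j. phist s j = h j)}
           {s. compress \<iota>1 \<iota> i t (phist s i) = k}
         = pmf (F g t k) (h i) * pmf (\<Phi> g t k) (x, h(i := undefined))))"
  proof -
    from assms show ?thesis
      unfolding USI_def by (elim exE conjE) (rule that)
  qed
  note fact = all[rule_format]
  have "belief_map G \<iota>1 \<iota> i (\<lambda>g n. \<Phi> g (Suc n))"
    unfolding belief_map_def Let_def
  proof (intro conjI allI impI)
    fix g n k
    assume g: "behavioral G g" and n: "n < horizon G"
      and ne: "set_pmf (mrun G g n) \<inter> info_is \<iota>1 \<iota> i n k \<noteq> {}"
    let ?P = "mrun G g n" and ?S = "info_is \<iota>1 \<iota> i n k :: ('x \<times> ('i \<Rightarrow> ('h, 'u, 'y) hist)) set"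
    let ?e = "\<lambda>(x, h). (h i, x, h(i := undefined))"
      and ?s = "\<lambda>s::('i, 'x, 'u, 'y, 'h) rstate. (rstate_x s, phist s)"
    let ?C = "cond_pmf ?P ?S"
    have inj: "inj ?e"
      by (rule inj_on_inverseI[where g="\<lambda>(a, x, h). (x, h(i := a))"]) auto
    have S: "{s. compress \<iota>1 \<iota> i (Suc n) (phist s i) = k} = ?s -` ?S" by auto
    have prob: "measure_pmf.prob (run G g n) (?s -` A) = measure_pmf.prob ?P A" for A
      by (simp add: run_eq_mrun[symmetric])
    have pos: "measure_pmf.prob ?P ?S > 0"
      using ne by (simp add: zero_less_measure_iff measure_pmf_zero_iff)
    have pos': "measure_pmf.prob (run G g n) {s. compress \<iota>1 \<iota> i (Suc n) (phist s i) = k} > 0"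
      unfolding S prob by (rule pos)
    have t: "Suc n \<in> {1..horizon G}" using n by simp
    have "map_pmf ?e ?C = pair_pmf (F g (Suc n) k) (\<Phi> g (Suc n) k)"
    \<comment> \<open>The USI equation speaks of \<open>\<Phi>\<close> only at functions whose entry
      \<open>i\<close> is \<open>undefined\<close>. Counting mass on the support of the left side
      excludes mass of the product anywhere else.\<close>
    proof (rule pmf_eqI_on_support)
      show "finite (set_pmf (map_pmf ?e ?C))" using ne by simp
      fix z assume "z \<in> set_pmf (map_pmf ?e ?C)"
      then obtain s where s: "z = ?e s" "s \<in> set_pmf ?C"
        unfolding set_map_pmf by (rule imageE)
      obtain x h where sx: "s = (x, h)" by (rule prod.exhaust)
      have z: "z = ?e (x, h)" and xh: "(x, h) \<in> ?S"
        using s ne unfolding sx by simp_all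
      have vim: "{s. rstate_x s = x \<and> (\<forall>j. phist s j = h j)} = ?s -` {(x, h)}" by auto
      have "pmf (map_pmf ?e ?C) z = pmf ?C (x, h)"
        unfolding z by (rule pmf_map_inj'[OF inj])
      also have "\<dots> = measure_pmf.prob ?P ({(x, h)} \<inter> ?S) / measure_pmf.prob ?P ?S"
        using xh ne by (simp add: pmf_cond measure_pmf_single)
      also have "\<dots> = cond_prob (run G g n) {s. rstate_x s = x \<and> (\<forall>j. phist s j = h j)}
           {s. compress \<iota>1 \<iota> i (Suc n) (phist s i) = k}"
        unfolding cond_prob_def vim S vimage_Int[symmetric] prob ..
      also have "\<dots> = pmf (F g (Suc n) k) (h i) * pmf (\<Phi> g (Suc n) k) (x, h(i := undefined))"
        using fact[OF g t, of k x h] pos' by (simp only: diff_Suc_1)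
      finally show "pmf (map_pmf ?e ?C) z = pmf (pair_pmf (F g (Suc n) k) (\<Phi> g (Suc n) k)) z"
        by (simp add: z pmf_pair)
    qed
    note C = this
    have "map_pmf (\<lambda>(x, h). h i) ?C = map_pmf fst (map_pmf ?e ?C)"
      by (simp only: pmf.map_comp o_def case_prod_beta' fst_conv)
    also have "\<dots> = F g (Suc n) k" by (simp only: C map_fst_pair_pmf)
    finally show "map_pmf ?e ?C = pair_pmf (map_pmf (\<lambda>(x, h). h i) ?C) (\<Phi> g (Suc n) k)"
      using C by (simp only:)
  next
    fix g g' :: "('i, 'h, 'u, 'y) profile"
    assume "\<forall>j. j \<noteq> i \<longrightarrow> g j = g' j"
    then have "\<Phi> g = \<Phi> g'" by (rule dep[THEN spec, THEN spec, THEN mp])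
    then show "(\<lambda>n. \<Phi> g (Suc n)) = (\<lambda>n. \<Phi> g' (Suc n))" by (simp only:)
  qed
  then show ?thesis by (rule that)
qed

section \<open>Conditioning on a full own history\<close>

lemma expectation_cond_pmf:
  fixes f :: "'a \<Rightarrow> real"
  assumes "finite (set_pmf p)" "set_pmf p \<inter> S \<noteq> {}"
  shows "measure_pmf.expectation p (\<lambda>s. of_bool (s \<in> S) * f s)
    = measure_pmf.prob p S * measure_pmf.expectation (cond_pmf p S) f"
proof -
  have pos: "measure_pmf.prob p S \<noteq> 0" using assms by (simp add: measure_pmf_zero_iff)
  have "measure_pmf.expectation (cond_pmf p S) f = (\<Sum>a\<in>set_pmf p. f a * pmf (cond_pmf p S) a)"
    using assms by (intro integral_measure_pmf_real) auto
  moreover have "measure_pmf.expectation p (\<lambda>s. of_bool (s \<in> S) * f s)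
      = (\<Sum>a\<in>set_pmf p. of_bool (a \<in> S) * f a * pmf p a)"
    using assms by (intro integral_measure_pmf_real) auto
  moreover have "of_bool (a \<in> S) * f a * pmf p a = measure_pmf.prob p S * (f a * pmf (cond_pmf p S) a)" for a
    using pos by (simp add: pmf_cond[OF assms(2)])
  ultimately show ?thesis
    by (simp add: sum_distrib_left)
qed

text \<open>Within a fibre of the compression the own history is independent of the state and the
  other histories, so learning \<open>h\<close> itself does not change the belief
  \<open>\<Phi>\<close> held at its compression.\<close>

lemma belief_expectation:
  fixes G :: "('i::finite, 'x::finite, 'u::finite, 'y, 'w::finite, 'h::finite) game"
  assumes bm: "belief_map G \<iota>1 \<iota> i \<Phi>" and g: "behavioral G g" and n: "n < horizon G"
    and pos: "measure_pmf.prob (mrun G g n) {s. snd s i = h} > 0"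
  shows "measure_pmf.expectation (mrun G g n) (\<lambda>(x, hh). of_bool (hh i = h) * \<xi> x (hh(i := undefined)))
    = measure_pmf.prob (mrun G g n) {s. snd s i = h}
      * measure_pmf.expectation (\<Phi> g n (compress \<iota>1 \<iota> i (Suc n) h)) (\<lambda>(x, hh). \<xi> x hh)"
proof -
  let ?k = "compress \<iota>1 \<iota> i (Suc n) h"
  let ?P = "mrun G g n" and ?S = "info_is \<iota>1 \<iota> i n ?k :: ('x \<times> ('i \<Rightarrow> ('h, 'u, 'y) hist)) set"
  let ?C = "cond_pmf ?P ?S"
  let ?F = "map_pmf (\<lambda>(x, h). h i) ?C"
  have ne: "set_pmf ?P \<inter> ?S \<noteq> {}"
    using pos unfolding zero_less_measure_iff measure_pmf_zero_iff by blast
  note C = belief_mapD[OF bm g n ne]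
  have finC: "finite (set_pmf ?C)" using ne by simp
  \<comment> \<open>Histories form an infinite type; the support is finite because the belief is a
    marginal of a finitely supported conditional law.\<close>
  have fin\<Phi>: "finite (set_pmf (\<Phi> g n ?k))"
  proof -
    have "\<Phi> g n ?k = map_pmf snd (pair_pmf ?F (\<Phi> g n ?k))" by (simp add: map_snd_pair_pmf)
    also have "finite (set_pmf \<dots>)" unfolding C[symmetric] using finC by simp
    finally show ?thesis .
  qed
  have *: "measure_pmf.expectation ?P (\<lambda>(x, hh). of_bool (hh i = h) * \<xi> x (hh(i := undefined)))
     = measure_pmf.prob ?P ?S * (measure_pmf.expectation ?F (\<lambda>h'. of_bool (h' = h))
         * measure_pmf.expectation (\<Phi> g n ?k) (\<lambda>(x, hh). \<xi> x hh))" for \<xi>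
  proof -
    have "measure_pmf.expectation ?P (\<lambda>(x, hh). of_bool (hh i = h) * \<xi> x (hh(i := undefined)))
        = measure_pmf.expectation ?P (\<lambda>s. of_bool (s \<in> ?S)
            * (of_bool (snd s i = h) * \<xi> (fst s) ((snd s)(i := undefined))))"
      by (intro expectation_cong_pmf) auto
    also have "\<dots> = measure_pmf.prob ?P ?S * measure_pmf.expectation ?C
        (\<lambda>s. of_bool (snd s i = h) * \<xi> (fst s) ((snd s)(i := undefined)))"
      by (rule expectation_cond_pmf[OF finite_mrun ne])
    also have "measure_pmf.expectation ?C (\<lambda>s. of_bool (snd s i = h) * \<xi> (fst s) ((snd s)(i := undefined)))
        = measure_pmf.expectation (map_pmf (\<lambda>(x, h). (h i, x, h(i := undefined))) ?C)
          (\<lambda>z. of_bool (fst z = h) * (\<lambda>(x, hh). \<xi> x hh) (snd z))"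
      by (simp add: case_prod_beta')
    also have "\<dots> = measure_pmf.expectation ?F (\<lambda>h'. of_bool (h' = h))
         * measure_pmf.expectation (\<Phi> g n ?k) (\<lambda>(x, hh). \<xi> x hh)"
      unfolding C by (rule expectation_pair_mult_finite) (use finC fin\<Phi> in \<open>simp_all only: set_map_pmf finite_imageI\<close>)
    finally show ?thesis .
  qed
  \<comment> \<open>The case of constant integrand 1 expresses the probability of \<open>h\<close>
    by the same two weights, which eliminates them from the general formula.\<close>
  have pr: "measure_pmf.prob ?P {s. snd s i = h} = measure_pmf.prob ?P ?S * measure_pmf.expectation ?F (\<lambda>h'. of_bool (h' = h))"
  proof -
    have "measure_pmf.prob ?P {s. snd s i = h} = measure_pmf.expectation ?P (\<lambda>s. of_bool (snd s i = h))"
      by (rule expectation_of_bool[symmetric])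
    also have "\<dots> = measure_pmf.expectation ?P (\<lambda>(x, hh). of_bool (hh i = h) * (\<lambda>_ _. 1) x (hh(i := undefined)))"
      by (simp only: case_prod_beta' mult_1_right)
    also have "\<dots> = measure_pmf.prob ?P ?S * (measure_pmf.expectation ?F (\<lambda>h'. of_bool (h' = h))
         * measure_pmf.expectation (\<Phi> g n ?k) (\<lambda>(x, hh). 1))"
      by (rule *)
    also have "measure_pmf.expectation (\<Phi> g n ?k) (\<lambda>(x, hh). 1) = (1 :: real)"
      by (simp add: case_prod_beta')
    finally show ?thesis by (simp only: mult_1_right)
  qed
  show ?thesis unfolding *[of \<xi>] pr by (rule mult.assoc[symmetric])
qed

section \<open>Fixing the action of one player\<close>

definition deviate :: "('i, 'h, 'u, 'y) profile \<Rightarrow> 'i \<Rightarrow> 'u \<Rightarrow> ('i, 'h, 'u, 'y) profile" where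
  "deviate g i a = g(i := \<lambda>_ _. return_pmf a)"

text \<open>The players randomize independently, so the action of player \<open>i\<close> may be
  drawn first; the constant strategy of \<open>deviate\<close> then merely records it.\<close>

lemma joint_act_split:
  fixes g :: "('i::finite, 'h, 'u, 'y) profile"
  shows "joint_act g t h = bind_pmf (g i t (h i)) (\<lambda>a. joint_act (deviate g i a) t h)"
proof -
  have U: "UNIV = insert i (UNIV - {i})" by auto
  let ?R = "Pi_pmf (UNIV - {i}) undefined (\<lambda>j. g j t (h j))"
  \<comment> \<open>Stated for every profile that agrees with \<open>g\<close> off \<open>i\<close>,
    so that it serves for \<open>g\<close> and for \<open>deviate g i a\<close> alike.\<close>
  have split: "joint_act g' t h = bind_pmf (g' i t (h i)) (\<lambda>a. map_pmf (\<lambda>f. f(i := a)) ?R)"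
    if "\<And>j. j \<noteq> i \<Longrightarrow> g' j = g j" for g' :: "('i, 'h, 'u, 'y) profile"
  proof -
    have "Pi_pmf (UNIV - {i}) undefined (\<lambda>j. g' j t (h j)) = ?R"
      using that by (intro Pi_pmf_cong) auto
    then show ?thesis
      unfolding joint_act_def by (subst U, subst Pi_pmf_insert') (auto simp: map_pmf_def)
  qed
  have "joint_act (deviate g i a) t h = map_pmf (\<lambda>f. f(i := a)) ?R" for a
    by (subst split) (auto simp: deviate_def bind_return_pmf)
  then show ?thesis using split[of g] by simp
qed

text \<open>A constant strategy does not consult its history. The own entry can thus be overwritten
  by \<open>undefined\<close>, the form in which \<open>\<Phi>\<close> delivers histories.\<close>

lemma joint_act_deviate_undefined:
  "joint_act (deviate g i a) t (h(i := h')) = joint_act (deviate g i a) t h"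
  unfolding joint_act_def by (intro arg_cong[where f="Pi_pmf UNIV undefined"]) (auto simp: deviate_def)

lemma deviate_cong:
  assumes "\<And>j. j \<noteq> i \<Longrightarrow> g j = g' j"
  shows "deviate g i a = deviate g' i a"
  using assms by (auto simp: deviate_def)

lemma joint_act_support: "u \<in> set_pmf (joint_act g t h) \<Longrightarrow> u i \<in> set_pmf (g i t (h i))"
  by (auto simp: joint_act_def set_Pi_pmf PiE_dflt_def)

lemma expectation_joint_act_component:
  fixes g :: "('i::finite, 'h, 'u::finite, 'y) profile" and \<theta> :: "('i \<Rightarrow> 'u) \<Rightarrow> real"
  shows "measure_pmf.expectation (joint_act g t h) (\<lambda>u. of_bool (u i = a) * \<theta> u)
    = pmf (g i t (h i)) a * measure_pmf.expectation (joint_act (deviate g i a) t h) \<theta>"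
proof -
  have "measure_pmf.expectation (joint_act g t h) (\<lambda>u. of_bool (u i = a) * \<theta> u)
     = measure_pmf.expectation (g i t (h i)) (\<lambda>b. measure_pmf.expectation (joint_act (deviate g i b) t h)
          (\<lambda>u. of_bool (u i = a) * \<theta> u))"
    by (subst joint_act_split[of _ _ _ i]) (simp add: expectation_bind_finite)
  also have "\<dots> = measure_pmf.expectation (g i t (h i)) (\<lambda>b. of_bool (b = a) *
       measure_pmf.expectation (joint_act (deviate g i a) t h) \<theta>)"
  proof (intro expectation_cong_pmf, goal_cases)
    case (1 b)
    have "measure_pmf.expectation (joint_act (deviate g i b) t h) (\<lambda>u. of_bool (u i = a) * \<theta> u)
       = measure_pmf.expectation (joint_act (deviate g i b) t h) (\<lambda>u. of_bool (b = a) * \<theta> u)"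
      by (intro expectation_cong_pmf) (auto dest: joint_act_support[where i=i] simp: deviate_def)
    then show ?case by simp
  qed
  also have "\<dots> = pmf (g i t (h i)) a * measure_pmf.expectation (joint_act (deviate g i a) t h) \<theta>"
    by (simp add: expectation_of_bool measure_pmf_single)
  finally show ?thesis .
qed

text \<open>
Conditional expectation of \<open>\<psi>\<close>(X_{n+2}, Y_{n+1}, R_{n+1}) given that player i has compressed information k and plays a.
\<close>

definition response :: "('i::finite, 'x, 'u, 'y, 'w, 'h) game \<Rightarrow> 'i
    \<Rightarrow> (('i, 'h, 'u, 'y) profile \<Rightarrow> nat \<Rightarrow> 'k \<Rightarrow> ('x \<times> ('i \<Rightarrow> ('h, 'u, 'y) hist)) pmf)
    \<Rightarrow> ('i, 'h, 'u, 'y) profile \<Rightarrow> nat \<Rightarrow> 'k \<Rightarrow> 'u \<Rightarrow> ('x \<times> ('i \<Rightarrow> 'y) \<times> ('i \<Rightarrow> real) \<Rightarrow> real) \<Rightarrow> real" where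
  "response G i \<Phi> g n k a \<psi> = measure_pmf.expectation (\<Phi> g n k) (\<lambda>(x, hh).
     measure_pmf.expectation (joint_act (deviate g i a) (Suc n) hh) (\<lambda>u.
       measure_pmf.expectation (outcome G (Suc n) x u) \<psi>))"

text \<open>Once the own action is split off, the integrand depends only on the state and the other
  histories, and these follow the belief at the compression of \<open>h\<close>. The own strategy
  survives in the first two factors alone.\<close>

lemma stage_response:
  fixes G :: "('i::finite, 'x::finite, 'u::finite, 'y, 'w::finite, 'h::finite) game"
  assumes bm: "belief_map G \<iota>1 \<iota> i \<Phi>" and g: "behavioral G g" and n: "n < horizon G"
    and pos: "measure_pmf.prob (mrun G g n) {s. snd s i = h} > 0"
  shows "measure_pmf.expectation (stage G g n) (\<lambda>(x, hh, u, z). of_bool (hh i = h \<and> u i = a) * \<psi> z)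
    = measure_pmf.prob (mrun G g n) {s. snd s i = h} * pmf (g i (Suc n) h) a
      * response G i \<Phi> g n (compress \<iota>1 \<iota> i (Suc n) h) a \<psi>"
proof -
  have "measure_pmf.expectation (stage G g n) (\<lambda>(x, hh, u, z). of_bool (hh i = h \<and> u i = a) * \<psi> z)
    = measure_pmf.expectation (mrun G g n) (\<lambda>(x, hh). of_bool (hh i = h) *
        measure_pmf.expectation (joint_act g (Suc n) hh) (\<lambda>u. of_bool (u i = a)
          * measure_pmf.expectation (outcome G (Suc n) x u) \<psi>))"
    by (simp add: stage_def stage_of_def expectation_bind_finite case_prod_beta' of_bool_conj mult.assoc)
  also have "\<dots> = pmf (g i (Suc n) h) a * measure_pmf.expectation (mrun G g n)
      (\<lambda>(x, hh). of_bool (hh i = h) * (\<lambda>x hh.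
        measure_pmf.expectation (joint_act (deviate g i a) (Suc n) hh) (\<lambda>u.
           measure_pmf.expectation (outcome G (Suc n) x u) \<psi>)) x (hh(i := undefined)))"
    by (subst Bochner_Integration.integral_mult_right_zero[symmetric], intro expectation_cong_pmf)
      (auto simp: expectation_joint_act_component joint_act_deviate_undefined)
  also have "\<dots> = pmf (g i (Suc n) h) a * (measure_pmf.prob (mrun G g n) {s. snd s i = h}
      * response G i \<Phi> g n (compress \<iota>1 \<iota> i (Suc n) h) a \<psi>)"
    by (subst belief_expectation[OF bm g n pos]) (simp add: response_def)
  finally show ?thesis by (simp add: ac_simps)
qed

text \<open>Both ingredients of \<open>response\<close> ignore the strategy of player
  \<open>i\<close>: the belief by USI, and the deviation because it overwrites that
  strategy.\<close>

lemma response_cong: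
  assumes "belief_map G \<iota>1 \<iota> i \<Phi>" "\<And>j. j \<noteq> i \<Longrightarrow> g j = g' j"
  shows "response G i \<Phi> g n k a \<psi> = response G i \<Phi> g' n k a \<psi>"
proof -
  have "\<forall>g g'. (\<forall>j. j \<noteq> i \<longrightarrow> g j = g' j) \<longrightarrow> \<Phi> g = \<Phi> g'"
    using assms(1) unfolding belief_map_def by (rule conjunct1)
  then have "\<Phi> g = \<Phi> g'"
    using assms(2) by (elim allE[of _ g] allE[of _ g'] impE) simp_all
  then show ?thesis
    using deviate_cong[of i g g' a, OF assms(2)] by (simp add: response_def)
qed

subsection \<open>Averaging a strategy over the compressed information\<close>

text \<open>At compressed information of probability zero the uniform choice is a default that keeps
  the averaged strategy fully mixed.\<close>

definition mean_act :: "('i::finite, 'x, 'u, 'y, 'w, 'h) game \<Rightarrow> ('i \<Rightarrow> 'h \<Rightarrow> 'k)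
    \<Rightarrow> ('i \<Rightarrow> nat \<Rightarrow> 'k \<Rightarrow> 'u \<times> 'y \<Rightarrow> 'k) \<Rightarrow> 'i \<Rightarrow> ('i, 'h, 'u, 'y) profile \<Rightarrow> nat \<Rightarrow> 'k \<Rightarrow> 'u pmf" where
  "mean_act G \<iota>1 \<iota> i g n k =
     (if set_pmf (mrun G g n) \<inter> info_is \<iota>1 \<iota> i n k \<noteq> {}
      then bind_pmf (cond_pmf (mrun G g n) (info_is \<iota>1 \<iota> i n k)) (\<lambda>(x, h). g i (Suc n) (h i))
      else pmf_of_set (acts G i (Suc n)))"

definition mean_profile :: "('i::finite, 'x, 'u, 'y, 'w, 'h) game \<Rightarrow> ('i \<Rightarrow> 'h \<Rightarrow> 'k)
    \<Rightarrow> ('i \<Rightarrow> nat \<Rightarrow> 'k \<Rightarrow> 'u \<times> 'y \<Rightarrow> 'k) \<Rightarrow> 'i \<Rightarrow> ('i, 'h, 'u, 'y) profile \<Rightarrow> ('i, 'h, 'u, 'y) profile" where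
  "mean_profile G \<iota>1 \<iota> i g =
     g(i := \<lambda>t h. mean_act G \<iota>1 \<iota> i g (t - 1) (compress \<iota>1 \<iota> i t h))"

text \<open>Averaging alters the law of the own history given its compression, so the two runs can
  only be compared after the own history is replaced by that compression.\<close>

definition forget :: "('i \<Rightarrow> 'h \<Rightarrow> 'k) \<Rightarrow> ('i \<Rightarrow> nat \<Rightarrow> 'k \<Rightarrow> 'u \<times> 'y \<Rightarrow> 'k) \<Rightarrow> 'i \<Rightarrow> nat
    \<Rightarrow> 'x \<times> ('i \<Rightarrow> ('h, 'u, 'y) hist) \<Rightarrow> 'x \<times> 'k \<times> ('i \<Rightarrow> ('h, 'u, 'y) hist)" where
  "forget \<iota>1 \<iota> i n = (\<lambda>(x, h). (x, compress \<iota>1 \<iota> i (Suc n) (h i), h(i := undefined)))"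

definition forget_stage :: "('i \<Rightarrow> 'h \<Rightarrow> 'k) \<Rightarrow> ('i \<Rightarrow> nat \<Rightarrow> 'k \<Rightarrow> 'u \<times> 'y \<Rightarrow> 'k) \<Rightarrow> 'i \<Rightarrow> nat
    \<Rightarrow> 'x \<times> ('i \<Rightarrow> ('h, 'u, 'y) hist) \<times> 'z \<Rightarrow> 'x \<times> 'k \<times> ('i \<Rightarrow> ('h, 'u, 'y) hist) \<times> 'z" where
  "forget_stage \<iota>1 \<iota> i n = (\<lambda>(x, h, z). (x, compress \<iota>1 \<iota> i (Suc n) (h i), h(i := undefined), z))"

definition act_kernel where
  "act_kernel G g i n x k hm a = bind_pmf (joint_act (deviate g i a) (Suc n) hm)
      (\<lambda>u. map_pmf (\<lambda>z. (x, k, hm, u, z)) (outcome G (Suc n) x u))"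

lemma forget_stage_eq:
  fixes G :: "('i::finite, 'x, 'u, 'y, 'w, 'h) game"
  shows "map_pmf (forget_stage \<iota>1 \<iota> i n) (stage G g n) = bind_pmf (mrun G g n) (\<lambda>(x, h).
     bind_pmf (g i (Suc n) (h i)) (act_kernel G g i n x (compress \<iota>1 \<iota> i (Suc n) (h i)) (h(i := undefined))))"
  unfolding stage_map act_kernel_def joint_act_deviate_undefined
  by (subst joint_act_split[of _ _ _ i]) (simp add: bind_assoc_pmf forget_stage_def)

lemma forget_stage_compressed:
  fixes G :: "('i::finite, 'x, 'u, 'y, 'w, 'h) game"
  assumes "\<And>h. g i (Suc n) h = \<rho> (compress \<iota>1 \<iota> i (Suc n) h)"
  shows "map_pmf (forget_stage \<iota>1 \<iota> i n) (stage G g n) =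
    bind_pmf (map_pmf (forget \<iota>1 \<iota> i n) (mrun G g n)) (\<lambda>(x, k, hm). bind_pmf (\<rho> k) (act_kernel G g i n x k hm))"
  unfolding forget_stage_eq by (simp add: bind_map_pmf forget_def case_prod_beta' assms)

text \<open>Given \<open>k\<close>, the own action depends on the own history, which is independent
  of the state and the other histories. Hence the action is independent of them too, with law
  \<open>mean_act\<close>.\<close>

lemma forget_stage_mean:
  fixes G :: "('i::finite, 'x, 'u, 'y, 'w, 'h) game"
  assumes bm: "belief_map G \<iota>1 \<iota> i \<Phi>" and g: "behavioral G g" and n: "n < horizon G"
  shows "map_pmf (forget_stage \<iota>1 \<iota> i n) (stage G g n) =
    bind_pmf (map_pmf (forget \<iota>1 \<iota> i n) (mrun G g n))
      (\<lambda>(x, k, hm). bind_pmf (mean_act G \<iota>1 \<iota> i g n k) (act_kernel G g i n x k hm))"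
proof -
  let ?P = "mrun G g n" and ?K = "\<lambda>s. compress \<iota>1 \<iota> i (Suc n) (snd s i)"
  let ?M = "act_kernel G g i n" and ?\<rho> = "mean_act G \<iota>1 \<iota> i g n"
  let ?C = "\<lambda>k. cond_pmf ?P {s. ?K s = k}"
  have fibre: "bind_pmf (?C k) (\<lambda>(x, h). bind_pmf (g i (Suc n) (h i)) (?M x (?K (x, h)) (h(i := undefined))))
      = bind_pmf (?C k) (\<lambda>(x, h). bind_pmf (?\<rho> (?K (x, h))) (?M x (?K (x, h)) (h(i := undefined))))"
    if "k \<in> set_pmf (map_pmf ?K ?P)" for k
  proof -
    have ne: "set_pmf ?P \<inter> {s. ?K s = k} \<noteq> {}" using that by auto
    note C = belief_mapD[OF bm g n ne]
    let ?F = "map_pmf (\<lambda>(x, h). h i) (?C k)"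
    have \<rho>: "?\<rho> k = bind_pmf ?F (g i (Suc n))"
      using ne by (simp add: mean_act_def bind_map_pmf case_prod_beta')
    have \<Phi>: "map_pmf (\<lambda>(x, h). (x, h(i := undefined))) (?C k) = \<Phi> g n k"
    proof -
      have "map_pmf (\<lambda>(x, h). (x, h(i := undefined))) (?C k)
          = map_pmf snd (map_pmf (\<lambda>(x, h). (h i, x, h(i := undefined))) (?C k))"
        by (simp only: pmf.map_comp o_def case_prod_beta' snd_conv)
      also have "\<dots> = \<Phi> g n k" by (simp only: C map_snd_pair_pmf)
      finally show ?thesis .
    qed
    have "bind_pmf (?C k) (\<lambda>(x, h). bind_pmf (g i (Suc n) (h i)) (?M x (?K (x, h)) (h(i := undefined))))
        = bind_pmf (?C k) (\<lambda>(x, h). bind_pmf (g i (Suc n) (h i)) (?M x k (h(i := undefined))))"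
      using ne by (intro bind_pmf_cong) auto
    also have "\<dots> = bind_pmf (map_pmf (\<lambda>(x, h). (h i, x, h(i := undefined))) (?C k))
        (\<lambda>(h, x, hm). bind_pmf (g i (Suc n) h) (?M x k hm))"
      by (simp add: bind_map_pmf case_prod_beta')
    also have "\<dots> = bind_pmf ?F (\<lambda>h. bind_pmf (\<Phi> g n k) (\<lambda>(x, hm). bind_pmf (g i (Suc n) h) (?M x k hm)))"
      unfolding C by (simp add: pair_pmf_def bind_assoc_pmf bind_return_pmf case_prod_beta')
    \<comment> \<open>Independence permits drawing the action before the pair
      \<open>(x, hm)\<close>; the own history then enters only through the mixture
      \<open>?\<rho> k\<close>.\<close>
    also have "\<dots> = bind_pmf ?F (\<lambda>h. bind_pmf (g i (Suc n) h) (\<lambda>a. bind_pmf (\<Phi> g n k) (\<lambda>(x, hm). ?M x k hm a)))"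
      unfolding case_prod_beta' by (intro bind_pmf_cong refl bind_commute_pmf)
    also have "\<dots> = bind_pmf (?\<rho> k) (\<lambda>a. bind_pmf (\<Phi> g n k) (\<lambda>(x, hm). ?M x k hm a))"
      by (simp only: \<rho> bind_assoc_pmf)
    also have "\<dots> = bind_pmf (\<Phi> g n k) (\<lambda>(x, hm). bind_pmf (?\<rho> k) (?M x k hm))"
      unfolding case_prod_beta' by (rule bind_commute_pmf)
    also have "\<dots> = bind_pmf (?C k) (\<lambda>(x, h). bind_pmf (?\<rho> k) (?M x k (h(i := undefined))))"
      by (simp add: \<Phi>[symmetric] bind_map_pmf case_prod_beta')
    also have "\<dots> = bind_pmf (?C k) (\<lambda>(x, h). bind_pmf (?\<rho> (?K (x, h))) (?M x (?K (x, h)) (h(i := undefined))))"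
      using ne by (intro bind_pmf_cong) auto
    finally show ?thesis .
  qed
  have "map_pmf (forget_stage \<iota>1 \<iota> i n) (stage G g n) = bind_pmf (bind_pmf (map_pmf ?K ?P) ?C)
      (\<lambda>(x, h). bind_pmf (g i (Suc n) (h i)) (?M x (?K (x, h)) (h(i := undefined))))"
    by (simp add: forget_stage_eq bind_cond_pmf_fibre)
  also have "\<dots> = bind_pmf (bind_pmf (map_pmf ?K ?P) ?C)
      (\<lambda>(x, h). bind_pmf (?\<rho> (?K (x, h))) (?M x (?K (x, h)) (h(i := undefined))))"
    unfolding bind_assoc_pmf by (intro bind_pmf_cong refl fibre)
  also have "\<dots> = bind_pmf (map_pmf (forget \<iota>1 \<iota> i n) ?P) (\<lambda>(x, k, hm). bind_pmf (?\<rho> k) (?M x k hm))"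
    by (simp add: bind_cond_pmf_fibre bind_map_pmf forget_def case_prod_beta')
  finally show ?thesis .
qed

lemma length_mrun:
  assumes "(x, h) \<in> set_pmf (mrun G g n)"
  shows "length (snd (h i)) = n"
proof -
  from assms obtain s where "s \<in> set_pmf (run G g n)" "h = phist s"
    by (auto simp: run_eq_mrun[symmetric])
  then show ?thesis using length_run[of s G g n] by (simp add: phist_def case_prod_beta')
qed

lemma compress_extend:
  assumes "length (snd h) = n"
  shows "compress \<iota>1 \<iota> i (Suc (Suc n)) (extend h z) = \<iota> i (Suc (Suc n)) (compress \<iota>1 \<iota> i (Suc n) h) z"
proof -
  have "compress_aux \<iota>1 \<iota> i m (extend h z) = compress_aux \<iota>1 \<iota> i m h" if "m \<le> n" for m
    using that assms by (induction m) (auto simp: extend_def nth_append)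
  then show ?thesis using assms by (simp add: compress_def extend_def nth_append)
qed

text \<open>Compressed information is updated from its old value and the new own observation, so the
  next forgotten state is a function of the forgotten stage.\<close>

lemma forget_mrun_Suc:
  fixes G :: "('i::finite, 'x, 'u, 'y, 'w, 'h) game"
  shows "map_pmf (forget \<iota>1 \<iota> i (Suc n)) (mrun G g (Suc n)) =
    map_pmf (\<lambda>(x, k, hm, u, x', y, r). (x', \<iota> i (Suc (Suc n)) k (u i, y i), (\<lambda>j. extend (hm j) (u j, y j))(i := undefined)))
      (map_pmf (forget_stage \<iota>1 \<iota> i n) (stage G g n))"
  unfolding mrun.simps stage_def[symmetric] pmf.map_comp
proof (rule map_pmf_cong[OF refl], goal_cases)
  case (1 s)
  obtain x h u x' y r where s: "s = (x, h, u, x', y, r)" by (metis prod.exhaust)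
  have "(x, h) \<in> set_pmf (mrun G g n)"
    using 1 unfolding s stage_def stage_of_def by auto
  then show ?case
    using length_mrun[of x h G g n i]
    by (auto simp: s forget_def forget_stage_def compress_extend fun_eq_iff)
qed

text \<open>Induction over the stages: equal forgotten laws enter the same kernel, for
  \<open>g\<close> by \<open>forget_stage_mean\<close> and for the averaged profile because its own
  strategy reads only \<open>k\<close>.\<close>

lemma forget_mean_profile:
  fixes G :: "('i::finite, 'x, 'u, 'y, 'w, 'h) game"
  assumes bm: "belief_map G \<iota>1 \<iota> i \<Phi>" and g: "behavioral G g" and n: "n < horizon G"
  defines "g' \<equiv> mean_profile G \<iota>1 \<iota> i g"
  shows "map_pmf (forget_stage \<iota>1 \<iota> i n) (stage G g' n) = map_pmf (forget_stage \<iota>1 \<iota> i n) (stage G g n)"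
proof -
  \<comment> \<open>The profiles differ only in the strategy that the deviation overwrites, so the
    stage kernels coincide.\<close>
  have "deviate g' i a = deviate g i a" for a
    by (simp add: g'_def mean_profile_def deviate_def)
  then have kern: "act_kernel G g' i m = act_kernel G g i m" for m
    by (intro ext) (simp only: act_kernel_def)
  have g'i: "g' i (Suc m) h = mean_act G \<iota>1 \<iota> i g m (compress \<iota>1 \<iota> i (Suc m) h)" for m h
    by (simp add: g'_def mean_profile_def)
  have st: "map_pmf (forget_stage \<iota>1 \<iota> i m) (stage G g' m) = map_pmf (forget_stage \<iota>1 \<iota> i m) (stage G g m)"
    if "map_pmf (forget \<iota>1 \<iota> i m) (mrun G g' m) = map_pmf (forget \<iota>1 \<iota> i m) (mrun G g m)" "m < horizon G" for m
    unfolding forget_stage_compressed[of g' i m, OF g'i] forget_stage_mean[OF bm g that(2)] that(1) kern ..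
  have "map_pmf (forget \<iota>1 \<iota> i m) (mrun G g' m) = map_pmf (forget \<iota>1 \<iota> i m) (mrun G g m)" if "m < horizon G" for m
    using that
  proof (induction m)
    case (Suc m)
    then show ?case unfolding forget_mrun_Suc using st[of m] by simp
  qed simp
  then show ?thesis using st n by blast
qed

text \<open>An integrand insensitive to the own history factors through \<open>forget_stage\<close>.
  With \<open>f = 1\<close> this gives payoffs, with events about another player it gives that
  player's action values.\<close>

lemma stage_reward_mean_profile:
  fixes G :: "('i::finite, 'x, 'u, 'y, 'w, 'h) game"
  assumes bm: "belief_map G \<iota>1 \<iota> i \<Phi>" and g: "behavioral G g" and n: "n < horizon G"
    and f: "\<And>h h'. f (h(i := h')) = f h"
  shows "measure_pmf.expectation (stage G (mean_profile G \<iota>1 \<iota> i g) n)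
       (\<lambda>(x, h, u, x', y, r). f (\<lambda>j. extend (h j) (u j, y j)) * b r)
     = measure_pmf.expectation (stage G g n)
       (\<lambda>(x, h, u, x', y, r). f (\<lambda>j. extend (h j) (u j, y j)) * (b r :: real))"
proof -
  have f': "f (\<lambda>j. extend ((h(i := undefined)) j) (u j, y j)) = f (\<lambda>j. extend (h j) (u j, y j))" for h u y
  proof -
    \<comment> \<open>Forgetting happens before the stage extends the histories, so entry
      \<open>i\<close> is an extended \<open>undefined\<close>; \<open>f\<close> ignores that
      entry.\<close>
    have "(\<lambda>j. extend ((h(i := undefined)) j) (u j, y j))
        = (\<lambda>j. extend (h j) (u j, y j))(i := extend undefined (u i, y i))"
      by (simp add: fun_eq_iff)
    then show ?thesis by (simp only: f)
  qed
  have "measure_pmf.expectation (stage G g' n) (\<lambda>(x, h, u, x', y, r). f (\<lambda>j. extend (h j) (u j, y j)) * b r)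
     = measure_pmf.expectation (map_pmf (forget_stage \<iota>1 \<iota> i n) (stage G g' n))
       (\<lambda>(x, k, h, u, x', y, r). f (\<lambda>j. extend (h j) (u j, y j)) * b r)" for g'
    by (simp add: forget_stage_def case_prod_beta' f'[unfolded fun_upd_def] fun_upd_def)
  then show ?thesis by (simp only: forget_mean_profile[OF bm g n])
qed

lemma payoff_mean_profile:
  fixes G :: "('i::finite, 'x::finite, 'u::finite, 'y, 'w::finite, 'h::finite) game"
  assumes bm: "belief_map G \<iota>1 \<iota> i \<Phi>" and g: "behavioral G g"
  shows "payoff G (mean_profile G \<iota>1 \<iota> i g) j = payoff G g j"
  unfolding payoff_eq_stage_reward stage_reward_def
  by (intro sum.cong refl stage_reward_mean_profile[OF bm g]) auto

lemma Qval_mean_profile_other: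
  fixes G :: "('i::finite, 'x::finite, 'u::finite, 'y, 'w::finite, 'h::finite) game"
  assumes bm: "belief_map G \<iota>1 \<iota> i \<Phi>" and g: "behavioral G g" and n: "n < horizon G" and "j \<noteq> i"
  shows "Qval G (mean_profile G \<iota>1 \<iota> i g) j (Suc n) h a = Qval G g j (Suc n) h a"
proof -
  have "Qden G (mean_profile G \<iota>1 \<iota> i g) j n h a = Qden G g j n h a"
    using stage_reward_mean_profile[OF bm g n, of "\<lambda>hh. of_bool (played n h a (hh j))" "\<lambda>_. 1"] \<open>j \<noteq> i\<close>
    by (simp add: Qden_eq[OF n])
  moreover have "Qnum G (mean_profile G \<iota>1 \<iota> i g) j n h a = Qnum G g j n h a"
    unfolding Qnum_eq_stage_reward[OF n] stage_reward_def
    by (intro sum.cong refl stage_reward_mean_profile[OF bm g]) (use \<open>j \<noteq> i\<close> in auto)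
  ultimately show ?thesis by (simp add: Qval_eq[OF n])
qed

subsection \<open>Recursion for the action values\<close>

lemma played_extend:
  assumes "length (snd h') = n"
  shows "played n h a (extend h' z) \<longleftrightarrow> h' = h \<and> fst z = a"
  using assms by (auto simp: played_def extend_def prod_eq_iff)

lemma extend_inject: "extend h z = extend h' z' \<longleftrightarrow> h = h' \<and> z = z'"
  by (auto simp: extend_def prod_eq_iff)

lemma stage_support:
  assumes "(x, h, u, x', y, r) \<in> set_pmf (stage G g n)"
  shows "(x, h) \<in> set_pmf (mrun G g n)" "u \<in> set_pmf (joint_act g (Suc n) h)"
  using assms by (auto simp: stage_def stage_of_def)

lemma stage_played:
  fixes \<psi> :: "_ \<Rightarrow> real"
  shows "measure_pmf.expectation (stage G g n)
       (\<lambda>(x, h', u, x', y, r). of_bool (played n h a (extend (h' i) (u i, y i))) * \<psi> (x', y, r))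
     = measure_pmf.expectation (stage G g n)
       (\<lambda>(x, h', u, z). of_bool (h' i = h \<and> u i = a) * \<psi> z)"
proof (rule expectation_cong_pmf, goal_cases)
  case (1 s)
  obtain x h' u x' y r where s: "s = (x, h', u, x', y, r)" by (metis prod.exhaust)
  have "length (snd (h' i)) = n"
    using 1 unfolding s by (rule length_mrun[OF stage_support(1)])
  then show ?case by (simp add: s played_extend)
qed

lemma Qden_eq_prob:
  fixes G :: "('i::finite, 'x::finite, 'u::finite, 'y, 'w::finite, 'h::finite) game"
  assumes "n < horizon G"
  shows "Qden G g i n h a = measure_pmf.prob (mrun G g n) {s. snd s i = h} * pmf (g i (Suc n) h) a"
proof -
  have "Qden G g i n h a = measure_pmf.expectation (stage G g n)
       (\<lambda>(x, h', u, z). of_bool (h' i = h \<and> u i = a) * 1)"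
    unfolding Qden_eq[OF assms] using stage_played[of G g n h a i "\<lambda>_. 1"] by simp
  also have "\<dots> = measure_pmf.expectation (mrun G g n) (\<lambda>(x, hh). of_bool (hh i = h) *
        measure_pmf.expectation (joint_act g (Suc n) hh) (\<lambda>u. of_bool (u i = a) * 1))"
    by (simp add: stage_def stage_of_def expectation_bind_finite case_prod_beta' of_bool_conj)
  also have "\<dots> = measure_pmf.expectation (mrun G g n) (\<lambda>s. of_bool (snd s i = h) * pmf (g i (Suc n) h) a)"
    by (intro expectation_cong_pmf, subst expectation_joint_act_component) (auto simp: case_prod_beta')
  also have "\<dots> = measure_pmf.prob (mrun G g n) {s. snd s i = h} * pmf (g i (Suc n) h) a"
    by (simp add: expectation_of_bool)
  finally show ?thesis .
qed

text \<open>Unreached histories have the junk value 0, so in the limit every action is optimal there.\<close>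

lemma Qval_unreached:
  fixes G :: "('i::finite, 'x::finite, 'u::finite, 'y, 'w::finite, 'h::finite) game"
  assumes "n < horizon G" "measure_pmf.prob (mrun G g n) {s. snd s i = h} = 0"
  shows "Qval G g i (Suc n) h a = 0"
  using assms by (simp add: Qval_eq Qden_eq_prob)

lemma prob_extend_response:
  fixes G :: "('i::finite, 'x::finite, 'u::finite, 'y, 'w::finite, 'h::finite) game"
  assumes bm: "belief_map G \<iota>1 \<iota> i \<Phi>" and g: "behavioral G g" and n: "n < horizon G"
    and pos: "measure_pmf.prob (mrun G g n) {s. snd s i = h} > 0"
  shows "measure_pmf.prob (mrun G g (Suc n)) {s. snd s i = extend h (a, b)}
    = measure_pmf.prob (mrun G g n) {s. snd s i = h} * pmf (g i (Suc n) h) a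
      * response G i \<Phi> g n (compress \<iota>1 \<iota> i (Suc n) h) a (\<lambda>(x', y, r). of_bool (y i = b))"
proof -
  have "measure_pmf.prob (mrun G g (Suc n)) {s. snd s i = extend h (a, b)}
     = measure_pmf.expectation (mrun G g (Suc n)) (\<lambda>s. of_bool (snd s i = extend h (a, b)))"
    by (rule expectation_of_bool[symmetric])
  also have "\<dots> = measure_pmf.expectation (stage G g n)
      (\<lambda>(x, h', u, z). of_bool (h' i = h \<and> u i = a) * (\<lambda>(x', y, r). of_bool (y i = b)) z)"
    by (simp add: stage_def[symmetric] case_prod_beta' extend_inject of_bool_conj mult.assoc)
  also have "\<dots> = measure_pmf.prob (mrun G g n) {s. snd s i = h} * pmf (g i (Suc n) h) a
      * response G i \<Phi> g n (compress \<iota>1 \<iota> i (Suc n) h) a (\<lambda>(x', y, r). of_bool (y i = b))"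
    by (rule stage_response[OF bm g n pos])
  finally show ?thesis .
qed

lemma played_Suc:
  assumes "Suc n < length (snd h')"
  shows "played (Suc n) (extend h (a, b)) a' h' \<longleftrightarrow>
    played n h a h' \<and> b = snd (snd h' ! n) \<and> a' = fst (snd h' ! Suc n)"
  using assms by (auto simp: played_def extend_def take_Suc_conv_app_nth prod_eq_iff)

text \<open>The reward of stage \<open>n\<close> is separated from the later ones, and the event for
  the latter is split by the next own observation \<open>b\<close> and the next own action
  \<open>a'\<close>.\<close>

lemma Qnum_rec:
  fixes G :: "('i::finite, 'x::finite, 'u::finite, 'y::finite, 'w::finite, 'h::finite) game"
  assumes n: "n < horizon G"
  shows "Qnum G g i n h a = measure_pmf.expectation (stage G g n)
       (\<lambda>(x, h', u, z). of_bool (h' i = h \<and> u i = a) * (\<lambda>(x', y, r). r i) z)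
     + (if Suc n < horizon G then \<Sum>b\<in>UNIV. \<Sum>a'\<in>UNIV. Qnum G g i (Suc n) (extend h (a, b)) a' else 0)"
proof -
  let ?T = "horizon G" and ?R = "full_run G g"
  let ?rs = "\<lambda>s::('i, 'x, 'u, 'y, 'h) rstate. snd (snd (snd s))"
  let ?tail = "\<lambda>m s. sum_list (map (\<lambda>r. r i) (drop m (?rs s)))"
  have len: "length (?rs s) = ?T" "length (snd (phist s i)) = ?T" if "s \<in> set_pmf ?R" for s
    using length_run[of s G g ?T] that by (auto simp: full_run_def phist_def case_prod_beta')
  have fin: "finite (set_pmf ?R)" by (simp add: full_run_def)
  have "Qnum G g i n h a = measure_pmf.expectation ?R (\<lambda>s. of_bool (played n h a (phist s i)) * (?rs s ! n) i
      + of_bool (played n h a (phist s i)) * ?tail (Suc n) s)"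
    unfolding Qnum_def
    by (intro expectation_cong_pmf) (use n in \<open>simp add: Cons_nth_drop_Suc[symmetric] len distrib_left\<close>)
  also have "\<dots> = measure_pmf.expectation ?R (\<lambda>s. of_bool (played n h a (phist s i)) * (?rs s ! n) i)
      + measure_pmf.expectation ?R (\<lambda>s. of_bool (played n h a (phist s i)) * ?tail (Suc n) s)"
    by (rule Bochner_Integration.integral_add) (rule integrable_measure_pmf_finite[OF fin])+
  also have "measure_pmf.expectation ?R (\<lambda>s. of_bool (played n h a (phist s i)) * (?rs s ! n) i)
      = measure_pmf.expectation (stage G g n)
       (\<lambda>(x, h', u, z). of_bool (h' i = h \<and> u i = a) * (\<lambda>(x', y, r). r i) z)"
    using expectation_run_stage[OF n, of G g "\<lambda>hh r. of_bool (played n h a (hh i)) * r i"]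
      stage_played[of G g n h a i "\<lambda>(x', y, r). r i"]
    by (simp add: full_run_def played_take)
  also have "measure_pmf.expectation ?R (\<lambda>s. of_bool (played n h a (phist s i)) * ?tail (Suc n) s)
     = (if Suc n < ?T then \<Sum>b\<in>UNIV. \<Sum>a'\<in>UNIV. Qnum G g i (Suc n) (extend h (a, b)) a' else 0)"
  proof (cases "Suc n < ?T")
    case True
    \<comment> \<open>When the event holds, exactly one pair \<open>(b, a')\<close> matches the
      recorded run; otherwise none does.\<close>
    have "of_bool (played n h a (phist s i)) * ?tail (Suc n) s = (\<Sum>b\<in>UNIV. \<Sum>a'\<in>UNIV.
        of_bool (played (Suc n) (extend h (a, b)) a' (phist s i)) * ?tail (Suc n) s)" if "s \<in> set_pmf ?R" for s
      using True len[OF that]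
      by (simp add: played_Suc of_bool_conj sum_distrib_right[symmetric] sum_distrib_left[symmetric])
    then have "measure_pmf.expectation ?R (\<lambda>s. of_bool (played n h a (phist s i)) * ?tail (Suc n) s)
       = measure_pmf.expectation ?R (\<lambda>s. \<Sum>b\<in>UNIV. \<Sum>a'\<in>UNIV.
          of_bool (played (Suc n) (extend h (a, b)) a' (phist s i)) * ?tail (Suc n) s)"
      by (rule expectation_cong_pmf)
    also have "\<dots> = (\<Sum>b\<in>UNIV. measure_pmf.expectation ?R (\<lambda>s. \<Sum>a'\<in>UNIV.
          of_bool (played (Suc n) (extend h (a, b)) a' (phist s i)) * ?tail (Suc n) s))"
      by (rule Bochner_Integration.integral_sum) (rule integrable_measure_pmf_finite[OF fin])
    also have "\<dots> = (\<Sum>b\<in>UNIV. \<Sum>a'\<in>UNIV. Qnum G g i (Suc n) (extend h (a, b)) a')"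
      unfolding Qnum_def
      by (intro sum.cong refl Bochner_Integration.integral_sum) (rule integrable_measure_pmf_finite[OF fin])
    finally show ?thesis using True by simp
  next
    case False
    then have "measure_pmf.expectation ?R (\<lambda>s. of_bool (played n h a (phist s i)) * ?tail (Suc n) s)
       = measure_pmf.expectation ?R (\<lambda>_. 0)"
      by (intro expectation_cong_pmf) (simp add: len)
    then show ?thesis using False by simp
  qed
  finally show ?thesis .
qed

lemma Qnum_eq_Qden_Qval:
  fixes G :: "('i::finite, 'x::finite, 'u::finite, 'y, 'w::finite, 'h::finite) game"
  assumes "n < horizon G"
  shows "Qnum G g i n h a = Qden G g i n h a * Qval G g i (Suc n) h a"
  using Qnum_zero[of G g i n h a] by (cases "Qden G g i n h a = 0") (auto simp: Qval_eq[OF assms])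

definition info_reward where
  "info_reward G i \<Phi> g n k a = response G i \<Phi> g n k a (\<lambda>(x', y, r). r i)"

definition info_obs where
  "info_obs G i \<Phi> g n k a b = response G i \<Phi> g n k a (\<lambda>(x', y, r). of_bool (y i = b))"

text \<open>Bellman recursion. Reward and observation weights depend on the history only through its
  compression and, of the profile, only on the other players.\<close>

lemma Qval_rec:
  fixes G :: "('i::finite, 'x::finite, 'u::finite, 'y::finite, 'w::finite, 'h::finite) game"
  assumes bm: "belief_map G \<iota>1 \<iota> i \<Phi>" and g: "behavioral G g" and n: "n < horizon G"
    and pos: "measure_pmf.prob (mrun G g n) {s. snd s i = h} > 0" and a: "a \<in> set_pmf (g i (Suc n) h)"
  shows "Qval G g i (Suc n) h a = info_reward G i \<Phi> g n (compress \<iota>1 \<iota> i (Suc n) h) a +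
    (if Suc n < horizon G then \<Sum>b\<in>UNIV. info_obs G i \<Phi> g n (compress \<iota>1 \<iota> i (Suc n) h) a b *
       (\<Sum>a'\<in>UNIV. pmf (g i (Suc (Suc n)) (extend h (a, b))) a' * Qval G g i (Suc (Suc n)) (extend h (a, b)) a')
     else 0)"
proof -
  let ?k = "compress \<iota>1 \<iota> i (Suc n) h"
  \<comment> \<open>\<open>D\<close> is the probability that player \<open>i\<close> reaches
    \<open>h\<close> and plays \<open>a\<close>. It is a factor of every term of the unnormalized
    recursion and cancels because it is positive.\<close>
  define D where "D = measure_pmf.prob (mrun G g n) {s. snd s i = h} * pmf (g i (Suc n) h) a"
  have D: "D > 0" using pos a by (simp add: D_def pmf_positive)
  have "Qnum G g i (Suc n) (extend h (a, b)) a' = D * (info_obs G i \<Phi> g n ?k a b *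
      (pmf (g i (Suc (Suc n)) (extend h (a, b))) a' * Qval G g i (Suc (Suc n)) (extend h (a, b)) a'))"
    if "Suc n < horizon G" for b a'
    using that by (simp add: Qnum_eq_Qden_Qval Qden_eq_prob D_def info_obs_def
        prob_extend_response[OF bm g n pos] del: mrun.simps)
  then have "Qnum G g i n h a = D * (info_reward G i \<Phi> g n ?k a +
    (if Suc n < horizon G then \<Sum>b\<in>UNIV. info_obs G i \<Phi> g n ?k a b *
       (\<Sum>a'\<in>UNIV. pmf (g i (Suc (Suc n)) (extend h (a, b))) a' * Qval G g i (Suc (Suc n)) (extend h (a, b)) a')
     else 0))"
    unfolding Qnum_rec[OF n] stage_response[OF bm g n pos] info_reward_def D_def[symmetric]
    by (simp add: distrib_left sum_distrib_left)
  then show ?thesis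
    using D by (simp add: Qval_eq[OF n] Qden_eq_prob[OF n] D_def[symmetric])
qed

text \<open>A nested expectation of an indicator. As bounded weights these probabilities preserve
  null sequences of continuation differences.\<close>

lemma info_obs_bounds: "0 \<le> info_obs G i \<Phi> g n k a b \<and> info_obs G i \<Phi> g n k a b \<le> 1"
proof -
  have E: "0 \<le> measure_pmf.expectation p f \<and> measure_pmf.expectation p f \<le> 1"
    if "\<And>x. 0 \<le> f x \<and> f x \<le> 1" for p and f :: "'z \<Rightarrow> real"
  proof -
    have "measure_pmf.expectation p f \<le> measure_pmf.expectation p (\<lambda>_. 1)"
      using that by (intro integral_mono measure_pmf.integrable_const_bound[where B=1]) auto
    then show ?thesis using that by (simp add: integral_nonneg_AE)
  qed
  show ?thesis unfolding info_obs_def response_def case_prod_beta'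
    by (intro E) simp
qed

subsection \<open>Fully mixed profiles and limits\<close>

lemma finite_hists:
  fixes G :: "('i, 'x, 'u::finite, 'y::finite, 'w, 'h::finite) game"
  shows "finite (hists G i t)"
proof (rule finite_subset)
  show "hists G i t \<subseteq> UNIV \<times> {zs. set zs \<subseteq> UNIV \<and> length zs = t - 1}"
    by (auto simp: hists_def)
qed (intro finite_cartesian_product finite_lists_length_eq; simp)

lemma extend_hists:
  "extend h z \<in> hists G i (Suc (Suc n)) \<longleftrightarrow> h \<in> hists G i (Suc n) \<and> fst z \<in> acts G i (Suc n)"
  by (auto simp: hists_def extend_def nth_append less_Suc_eq split: if_splits)

lemma set_joint_act: "set_pmf (joint_act g t h) = {u. \<forall>i. u i \<in> set_pmf (g i t (h i))}"
  by (auto simp: joint_act_def set_Pi_pmf PiE_dflt_def)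

lemma behavioralD:
  "behavioral G g \<Longrightarrow> n < horizon G \<Longrightarrow> h \<in> hists G i (Suc n) \<Longrightarrow> set_pmf (g i (Suc n) h) \<subseteq> acts G i (Suc n)"
  by (simp add: behavioral_def)

lemma fully_mixedD:
  "fully_mixed G g \<Longrightarrow> n < horizon G \<Longrightarrow> h \<in> hists G i (Suc n) \<Longrightarrow> set_pmf (g i (Suc n) h) = acts G i (Suc n)"
  by (simp add: fully_mixed_def)

lemma fully_mixed_imp_behavioral: "fully_mixed G g \<Longrightarrow> behavioral G g"
  by (simp add: fully_mixed_def behavioral_def)

lemma mrun_hists:
  assumes "behavioral G g" "n \<le> horizon G" "(x, h) \<in> set_pmf (mrun G g n)"
  shows "h i \<in> hists G i (Suc n)"
  using assms(2,3)
proof (induction n arbitrary: x h)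
  case 0
  then show ?case by (auto simp: hists_def)
next
  case (Suc n)
  then obtain s where s: "s \<in> set_pmf (stage G g n)"
    and xh: "(x, h) = (\<lambda>(x, h, u, x', y, r). (x', \<lambda>i. extend (h i) (u i, y i))) s"
    by (auto simp: stage_def)
  obtain x0 h0 u x' y r where s': "s = (x0, h0, u, x', y, r)" by (metis prod.exhaust)
  have h0: "h0 i \<in> hists G i (Suc n)"
    using Suc.IH[of x0 h0] stage_support(1)[OF s[unfolded s']] Suc.prems(1) by simp
  have "u i \<in> acts G i (Suc n)"
    using stage_support(2)[OF s[unfolded s']] behavioralD[OF assms(1) _ h0] Suc.prems
    by (auto simp: set_joint_act)
  then show ?case using xh h0 by (simp add: s' extend_hists)
qed

lemma set_mrun_Suc:
  "set_pmf (mrun G g (Suc n)) = (\<Union>(x, h)\<in>set_pmf (mrun G g n). \<Union>u\<in>set_pmf (joint_act g (Suc n) h).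
     (\<lambda>(x', y, r). (x', \<lambda>i. extend (h i) (u i, y i))) ` set_pmf (outcome G (Suc n) x u))"
  by (force simp: stage_of_def)

text \<open>Fully mixed profiles give every action draw the same support. Reachability is therefore
  common to all of them, and one member of a sequence can stand for the rest.\<close>

lemma fully_mixed_mrun_support:
  assumes "fully_mixed G g" "fully_mixed G g'" "n \<le> horizon G"
  shows "set_pmf (mrun G g n) = set_pmf (mrun G g' n)"
  using assms(3)
proof (induction n)
  case (Suc n)
  have "set_pmf (joint_act g (Suc n) h) = set_pmf (joint_act g' (Suc n) h)" if "(x, h) \<in> set_pmf (mrun G g n)" for x h
    using mrun_hists[OF fully_mixed_imp_behavioral[OF assms(1)] _ that] Suc.prems assms
    by (simp add: set_joint_act fully_mixedD)
  then show ?case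
    using Suc unfolding set_mrun_Suc case_prod_beta'
    by (intro SUP_cong) (metis Suc_leD prod.collapse | simp)+
qed simp

definition reachable :: "('i::finite, 'x, 'u, 'y, 'w, 'h) game \<Rightarrow> ('i, 'h, 'u, 'y) profile \<Rightarrow> 'i \<Rightarrow> nat \<Rightarrow> ('h, 'u, 'y) hist \<Rightarrow> bool" where
  "reachable G g i n h \<longleftrightarrow> measure_pmf.prob (mrun G g n) {s. snd s i = h} > 0"

lemma reachable_iff: "reachable G g i n h \<longleftrightarrow> (\<exists>s\<in>set_pmf (mrun G g n). snd s i = h)"
  unfolding reachable_def zero_less_measure_iff measure_pmf_zero_iff by blast

lemma reachable_fully_mixed:
  assumes "fully_mixed G g" "fully_mixed G g'" "n \<le> horizon G"
  shows "reachable G g i n h \<longleftrightarrow> reachable G g' i n h"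
  unfolding reachable_iff fully_mixed_mrun_support[OF assms] ..

section \<open>Continuity of the run in the profile\<close>

lemma tendsto_expectation_joint_act:
  fixes g :: "('i::finite, 'h, 'u::finite, 'y) profile"
  assumes "\<And>m. behavioral G (gs m)" "behavioral G g" "n < horizon G" "\<And>i. h i \<in> hists G i (Suc n)"
    and lim: "\<And>i h u. h \<in> hists G i (Suc n) \<Longrightarrow> u \<in> acts G i (Suc n) \<Longrightarrow>
       (\<lambda>m. pmf (gs m i (Suc n) h) u) \<longlonglongrightarrow> pmf (g i (Suc n) h) u"
  shows "(\<lambda>m. measure_pmf.expectation (joint_act (gs m) (Suc n) h) f)
      \<longlonglongrightarrow> measure_pmf.expectation (joint_act g (Suc n) h) (f :: _ \<Rightarrow> real)"
proof (rule tendsto_expectation[of UNIV])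
  fix u
  \<comment> \<open>Convergence is assumed at available actions only; at the others all
    probabilities are 0 by behaviorality.\<close>
  have "(\<lambda>m. pmf (gs m i (Suc n) (h i)) (u i)) \<longlonglongrightarrow> pmf (g i (Suc n) (h i)) (u i)" for i
  proof (cases "u i \<in> acts G i (Suc n)")
    case True
    then show ?thesis using lim assms(4) by blast
  next
    case False
    then have "pmf (gs m i (Suc n) (h i)) (u i) = 0" "pmf (g i (Suc n) (h i)) (u i) = 0" for m
      using behavioralD[OF assms(1) assms(3,4)] behavioralD[OF assms(2-4)]
      by (meson pmf_eq_0_set_pmf subsetD)+
    then show ?thesis by simp
  qed
  then show "(\<lambda>m. pmf (joint_act (gs m) (Suc n) h) u) \<longlonglongrightarrow> pmf (joint_act g (Suc n) h) u"
    by (simp add: joint_act_def pmf_Pi tendsto_prod)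
qed auto

lemma tendsto_expectation_stage:
  fixes G :: "('i::finite, 'x::finite, 'u::finite, 'y::finite, 'w::finite, 'h::finite) game"
  assumes beh: "\<And>m. behavioral G (gs m)" "behavioral G g" and n: "n < horizon G"
    and lim: "\<And>i t h u. t \<in> {1..horizon G} \<Longrightarrow> h \<in> hists G i t \<Longrightarrow> u \<in> acts G i t \<Longrightarrow>
       (\<lambda>m. pmf (gs m i t h) u) \<longlonglongrightarrow> pmf (g i t h) u"
  shows "(\<lambda>m. measure_pmf.expectation (stage G (gs m) n) f)
      \<longlonglongrightarrow> measure_pmf.expectation (stage G g n) (f :: _ \<Rightarrow> real)"
proof -
  \<comment> \<open>A finite set containing the supports of all runs at once, as required for
    passing to the limit under the expectation.\<close>
  let ?S = "\<lambda>n. UNIV \<times> {h. \<forall>i. h i \<in> hists G i (Suc n)} :: ('x \<times> ('i \<Rightarrow> ('h, 'u, 'y) hist)) set"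
  have fin: "finite (?S n)" for n
  proof -
    have "{h. \<forall>i. h i \<in> hists G i (Suc n)} = PiE UNIV (\<lambda>i. hists G i (Suc n))" by auto
    then show ?thesis by (simp add: finite_PiE finite_hists)
  qed
  have sub: "set_pmf (mrun G g' n) \<subseteq> ?S n" if "behavioral G g'" "n \<le> horizon G" for g' n
    using mrun_hists[OF that] by auto
  have step: "(\<lambda>m. measure_pmf.expectation (stage G (gs m) n) f) \<longlonglongrightarrow> measure_pmf.expectation (stage G g n) f"
    if n: "n < horizon G" and IH: "\<And>s. (\<lambda>m. pmf (mrun G (gs m) n) s) \<longlonglongrightarrow> pmf (mrun G g n) s"
    for n and f :: "_ \<Rightarrow> real"
  proof -
    have st: "measure_pmf.expectation (stage G g' n) f = measure_pmf.expectation (mrun G g' n)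
       (\<lambda>s. measure_pmf.expectation (joint_act g' (Suc n) (snd s)) (\<lambda>u.
          measure_pmf.expectation (outcome G (Suc n) (fst s) u) (\<lambda>z. f (fst s, snd s, u, z))))" for g'
      by (simp add: stage_def stage_of_def expectation_bind_finite case_prod_beta')
    show ?thesis unfolding st
    proof (rule tendsto_expectation[OF fin sub sub IH])
      fix s assume "s \<in> ?S n"
      then have "snd s i \<in> hists G i (Suc n)" for i by auto
      then show "(\<lambda>m. measure_pmf.expectation (joint_act (gs m) (Suc n) (snd s)) (\<lambda>u.
          measure_pmf.expectation (outcome G (Suc n) (fst s) u) (\<lambda>z. f (fst s, snd s, u, z))))
        \<longlonglongrightarrow> measure_pmf.expectation (joint_act g (Suc n) (snd s)) (\<lambda>u.
          measure_pmf.expectation (outcome G (Suc n) (fst s) u) (\<lambda>z. f (fst s, snd s, u, z)))"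
        using n by (intro tendsto_expectation_joint_act[OF beh n] lim) auto
    qed (use beh n in auto)
  qed
  have "(\<lambda>m. pmf (mrun G (gs m) n) s) \<longlonglongrightarrow> pmf (mrun G g n) s" if "n < horizon G" for n s
    using that
  proof (induction n arbitrary: s)
    case (Suc n)
    \<comment> \<open>A point mass of the next law is the stage expectation of an indicator, so
      \<open>step\<close> carries convergence from one time to the next.\<close>
    have "pmf (mrun G g' (Suc n)) s = measure_pmf.expectation (stage G g' n)
       (\<lambda>z. of_bool ((\<lambda>(x, h, u, x', y, r). (x', \<lambda>i. extend (h i) (u i, y i))) z = s))" for g'
      by (simp add: expectation_of_bool stage_def pmf_map vimage_def)
    then show ?case using step[of n] Suc by (simp del: mrun.simps)
  qed simp
  then show ?thesis using step n by blast
qed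

lemma payoff_tendsto:
  fixes G :: "('i::finite, 'x::finite, 'u::finite, 'y::finite, 'w::finite, 'h::finite) game"
  assumes "\<And>m. behavioral G (gs m)" "behavioral G g"
    and "\<And>i t h u. t \<in> {1..horizon G} \<Longrightarrow> h \<in> hists G i t \<Longrightarrow> u \<in> acts G i t \<Longrightarrow>
       (\<lambda>m. pmf (gs m i t h) u) \<longlonglongrightarrow> pmf (g i t h) u"
  shows "(\<lambda>m. payoff G (gs m) j) \<longlonglongrightarrow> payoff G g j"
  unfolding payoff_eq_stage_reward stage_reward_def
  by (intro tendsto_sum tendsto_expectation_stage assms) auto

section \<open>Averages of fully mixed profiles\<close>

lemma set_mean_act:
  fixes G :: "('i::finite, 'x::finite, 'u::finite, 'y::finite, 'w::finite, 'h::finite) game"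
  assumes "fully_mixed G g" "n < horizon G" "acts G i (Suc n) \<noteq> {}"
  shows "set_pmf (mean_act G \<iota>1 \<iota> i g n k) = acts G i (Suc n)"
proof (cases "set_pmf (mrun G g n) \<inter> info_is \<iota>1 \<iota> i n k = {}")
  case False
  let ?S = "set_pmf (mrun G g n) \<inter> info_is \<iota>1 \<iota> i n k"
  have "set_pmf (mean_act G \<iota>1 \<iota> i g n k) = (\<Union>s\<in>?S. set_pmf (g i (Suc n) (snd s i)))"
    using False by (simp add: mean_act_def case_prod_beta')
  also have "\<dots> = (\<Union>s\<in>?S. acts G i (Suc n))"
  proof (rule SUP_cong[OF refl])
    fix s assume "s \<in> ?S"
    then have "snd s i \<in> hists G i (Suc n)"
      using mrun_hists[OF fully_mixed_imp_behavioral[OF assms(1)], of n "fst s" "snd s"] assms(2) by simp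
    then show "set_pmf (g i (Suc n) (snd s i)) = acts G i (Suc n)"
      by (rule fully_mixedD[OF assms(1,2)])
  qed
  finally show ?thesis using False by auto
next
  case True
  then show ?thesis using assms(3) by (simp add: mean_act_def set_pmf_of_set)
qed

lemma fully_mixed_mean_profile:
  fixes G :: "('i::finite, 'x::finite, 'u::finite, 'y::finite, 'w::finite, 'h::finite) game"
  assumes "game_wf G" "fully_mixed G g"
  shows "fully_mixed G (mean_profile G \<iota>1 \<iota> i g)"
  unfolding fully_mixed_def
proof (intro allI ballI)
  fix j t h assume t: "t \<in> {1..horizon G}" and h: "h \<in> hists G j t"
  then obtain n where n: "t = Suc n" "n < horizon G" by (cases t) auto
  have "acts G i (Suc n) \<noteq> {}" for i using assms(1) t n by (auto simp: game_wf_def)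
  then show "set_pmf (mean_profile G \<iota>1 \<iota> i g j t h) = acts G j t"
    using fully_mixedD[OF assms(2) n(2)] h
    by (simp add: mean_profile_def n set_mean_act[OF assms(2) n(2)])
qed

text \<open>An average is at most the sum of the averaged terms. The crude bound suffices: if all
  terms on the fibre tend to 0, so does the averaged probability.\<close>

lemma pmf_mean_act_le:
  fixes G :: "('i::finite, 'x::finite, 'u::finite, 'y::finite, 'w::finite, 'h::finite) game"
  assumes "behavioral G g" "n < horizon G" "reachable G g i n h" "compress \<iota>1 \<iota> i (Suc n) h = k"
  shows "pmf (mean_act G \<iota>1 \<iota> i g n k) u \<le>
    (\<Sum>h\<in>{h \<in> hists G i (Suc n). reachable G g i n h \<and> compress \<iota>1 \<iota> i (Suc n) h = k}. pmf (g i (Suc n) h) u)"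
    (is "_ \<le> sum ?f ?A")
proof -
  let ?C = "cond_pmf (mrun G g n) (info_is \<iota>1 \<iota> i n k)"
  have ne: "set_pmf (mrun G g n) \<inter> info_is \<iota>1 \<iota> i n k \<noteq> {}"
    using assms(3,4) unfolding reachable_iff by blast
  have finC: "finite (set_pmf ?C)" using ne by simp
  have finA: "finite ?A" by (rule finite_subset[OF _ finite_hists[of G i "Suc n"]]) auto
  have in_A: "snd s i \<in> ?A" if "s \<in> set_pmf ?C" for s
    using that mrun_hists[OF assms(1), of n "fst s" "snd s" i] ne assms(2)
    by (auto simp: reachable_iff)
  have "pmf (mean_act G \<iota>1 \<iota> i g n k) u = measure_pmf.expectation ?C (\<lambda>s. ?f (snd s i))"
    using ne by (simp add: mean_act_def pmf_bind case_prod_beta')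
  also have "\<dots> \<le> measure_pmf.expectation ?C (\<lambda>_. sum ?f ?A)"
  proof (rule integral_mono_AE)
    show "AE s in ?C. ?f (snd s i) \<le> sum ?f ?A"
      unfolding AE_measure_pmf_iff by (intro ballI member_le_sum[OF in_A] pmf_nonneg finA)
  qed (intro integrable_measure_pmf_finite finC)+
  finally show ?thesis by simp
qed

subsection \<open>Action values in equilibrium\<close>

text \<open>All mass of the limit strategy lies on maximizers, so the limit value is the maximum
  whichever maximizers are chosen. Values under different limit strategies thus become
  comparable.\<close>

lemma tendsto_value:
  fixes p :: "nat \<Rightarrow> 'a::finite pmf" and q :: "nat \<Rightarrow> 'a \<Rightarrow> real"
  assumes sub: "\<And>m. set_pmf (p m) \<subseteq> A" and opt: "set_pmf p' \<subseteq> {a \<in> A. \<forall>b\<in>A. q' b \<le> q' a}"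
    and "\<And>a. a \<in> A \<Longrightarrow> (\<lambda>m. pmf (p m) a) \<longlonglongrightarrow> pmf p' a" "\<And>a. a \<in> A \<Longrightarrow> (\<lambda>m. q m a) \<longlonglongrightarrow> q' a"
  shows "(\<lambda>m. \<Sum>a\<in>UNIV. pmf (p m) a * q m a) \<longlonglongrightarrow> Max (q' ` A)"
proof -
  have "(\<Sum>a\<in>UNIV. pmf (p m) a * q m a) = (\<Sum>a\<in>A. pmf (p m) a * q m a)" for m
    by (rule sum.mono_neutral_right) (use sub[of m] in \<open>auto simp: set_pmf_iff\<close>)
  moreover have "(\<Sum>a\<in>A. pmf p' a * q' a) = Max (q' ` A)"
  proof -
    have "pmf p' a * q' a = pmf p' a * Max (q' ` A)" if "a \<in> A" for a
    proof (cases "a \<in> set_pmf p'")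
      case True
      then have "Max (q' ` A) = q' a" using opt by (intro Max_eqI) auto
      then show ?thesis by simp
    qed (simp add: set_pmf_iff)
    then have "(\<Sum>a\<in>A. pmf p' a * q' a) = (\<Sum>a\<in>A. pmf p' a) * Max (q' ` A)"
      unfolding sum_distrib_right by (rule sum.cong[OF refl])
    moreover have "(\<Sum>a\<in>A. pmf p' a) = 1" using opt by (intro sum_pmf_eq_1) auto
    ultimately show ?thesis by simp
  qed
  moreover have "(\<lambda>m. \<Sum>a\<in>A. pmf (p m) a * q m a) \<longlonglongrightarrow> (\<Sum>a\<in>A. pmf p' a * q' a)"
    using assms(3,4) by (intro tendsto_sum tendsto_mult) auto
  ultimately show ?thesis by simp
qed

definition cont_value where
  "cont_value G g i n h = (\<Sum>a\<in>UNIV. pmf (g i (Suc n) h) a * Qval G g i (Suc n) h a)"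

text \<open>Equal opponents and equal compression give equal rewards and observation weights in the
  Bellman recursion, so only continuation differences remain. It serves both for two histories under
  one sequence and for two sequences at one history.\<close>

lemma Qval_diff_tendsto:
  fixes G :: "('i::finite, 'x::finite, 'u::finite, 'y::finite, 'w::finite, 'h::finite) game"
  assumes bm: "belief_map G \<iota>1 \<iota> i \<Phi>" and n: "n < horizon G"
    and mixed: "\<And>m. fully_mixed G (g m)" "\<And>m. fully_mixed G (g' m)"
    and others: "\<And>m j. j \<noteq> i \<Longrightarrow> g m j = g' m j"
    and hist: "h \<in> hists G i (Suc n)" "h' \<in> hists G i (Suc n)"
    and reach: "reachable G (g 0) i n h" "reachable G (g 0) i n h'"
    and info: "compress \<iota>1 \<iota> i (Suc n) h = compress \<iota>1 \<iota> i (Suc n) h'"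
    and a: "a \<in> acts G i (Suc n)"
    and step: "\<And>b. Suc n < horizon G \<Longrightarrow> reachable G (g 0) i (Suc n) (extend h (a, b)) \<Longrightarrow>
        reachable G (g 0) i (Suc n) (extend h' (a, b)) \<Longrightarrow>
        (\<lambda>m. cont_value G (g m) i (Suc n) (extend h (a, b)) - cont_value G (g' m) i (Suc n) (extend h' (a, b))) \<longlonglongrightarrow> 0"
  shows "(\<lambda>m. Qval G (g m) i (Suc n) h a - Qval G (g' m) i (Suc n) h' a) \<longlonglongrightarrow> 0"
proof -
  let ?k = "compress \<iota>1 \<iota> i (Suc n) h"
  let ?o = "\<lambda>m. info_obs G i \<Phi> (g m) n ?k a"
  let ?d = "\<lambda>b m. cont_value G (g m) i (Suc n) (extend h (a, b)) - cont_value G (g' m) i (Suc n) (extend h' (a, b))"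
  have beh: "behavioral G (g m)" "behavioral G (g' m)" for m
    using mixed by (auto intro: fully_mixed_imp_behavioral)
  have reach_g: "reachable G (g m) i l z = reachable G (g 0) i l z" if "l \<le> horizon G" for m l z
    by (rule reachable_fully_mixed[OF mixed(1) mixed(1) that])
  have reach_g': "reachable G (g' m) i l z = reachable G (g 0) i l z" if "l \<le> horizon G" for m l z
    by (rule reachable_fully_mixed[OF mixed(2) mixed(1) that])
  have pos: "measure_pmf.prob (mrun G (g m) n) {s. snd s i = h} > 0"
    "measure_pmf.prob (mrun G (g m) n) {s. snd s i = h'} > 0"
    "measure_pmf.prob (mrun G (g' m) n) {s. snd s i = h'} > 0" for m
    using reach reach_g[of n m] reach_g'[of n m] n by (auto simp: reachable_def)
  have supp: "a \<in> set_pmf (g m i (Suc n) h)" "a \<in> set_pmf (g m i (Suc n) h')" "a \<in> set_pmf (g' m i (Suc n) h')" for m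
    using fully_mixedD[OF mixed(1) n] fully_mixedD[OF mixed(2) n] hist a by auto
  have reward: "info_reward G i \<Phi> (g' m) n ?k a = info_reward G i \<Phi> (g m) n ?k a"
    and obs: "info_obs G i \<Phi> (g' m) n ?k a b = ?o m b" for m b
    unfolding info_reward_def info_obs_def
    by (rule response_cong[OF bm], rule others[symmetric], assumption)+
  have "Qval G (g m) i (Suc n) h a - Qval G (g' m) i (Suc n) h' a
      = (if Suc n < horizon G then \<Sum>b\<in>UNIV. ?o m b * ?d b m else 0)" for m
    unfolding Qval_rec[OF bm beh(1) n pos(1) supp(1)] Qval_rec[OF bm beh(2) n pos(3) supp(3)]
      info[symmetric] reward obs cont_value_def
    by (simp add: right_diff_distrib sum_subtractf)
  \<comment> \<open>Whether the weight of \<open>b\<close> is positive does not depend on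
    \<open>m\<close>. If it is, both extended histories are reachable and \<open>step\<close>
    applies; if not, the term is 0.\<close>
  moreover have "(\<lambda>m. ?o m b * ?d b m) \<longlonglongrightarrow> 0" if T: "Suc n < horizon G" for b
  proof -
    have scale: "0 < D * x \<longleftrightarrow> 0 < x" if "0 < D" for D x :: real
      using that by (simp add: zero_less_mult_iff)
    have "0 < ?o m b \<longleftrightarrow> reachable G (g m) i (Suc n) (extend h (a, b))" for m
      unfolding reachable_def prob_extend_response[OF bm beh(1) n pos(1)] info_obs_def[symmetric]
      by (rule scale[symmetric]) (rule mult_pos_pos[OF pos(1) pmf_positive[OF supp(1)]])
    moreover have "0 < ?o m b \<longleftrightarrow> reachable G (g m) i (Suc n) (extend h' (a, b))" for m
      unfolding reachable_def prob_extend_response[OF bm beh(1) n pos(2)] info_obs_def[symmetric] info[symmetric]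
      by (rule scale[symmetric]) (rule mult_pos_pos[OF pos(2) pmf_positive[OF supp(2)]])
    ultimately have o: "0 < ?o m b \<longleftrightarrow> reachable G (g 0) i (Suc n) (extend h (a, b))"
      "0 < ?o m b \<longleftrightarrow> reachable G (g 0) i (Suc n) (extend h' (a, b))" for m
      using reach_g[of "Suc n" m] T by simp_all
    show ?thesis
    proof (cases "reachable G (g 0) i (Suc n) (extend h (a, b))")
      case True
      then have "?d b \<longlonglongrightarrow> 0" using step[OF T] o by blast
      then have lim: "(\<lambda>m. \<bar>?d b m\<bar>) \<longlonglongrightarrow> 0" by (rule tendsto_rabs_zero)
      have le: "norm (?o m b * ?d b m) \<le> \<bar>?d b m\<bar>" for m
        using info_obs_bounds[of G i \<Phi> "g m" n ?k a b]
        by (simp add: abs_mult mult_left_le_one_le)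
      show ?thesis by (rule Lim_null_comparison[OF always_eventually[OF allI, OF le] lim])
    next
      case False
      then have "?o m b = 0" for m
        using o(1)[of m] info_obs_bounds[of G i \<Phi> "g m" n ?k a b] by linarith
      then show ?thesis by simp
    qed
  qed
  ultimately show ?thesis
    by (cases "Suc n < horizon G") (auto intro: tendsto_null_sum)
qed

text \<open>Backward induction on \<open>horizon G - n\<close>. The strategies at the two histories
  may differ, but rationality replaces both continuation values by maxima of \<open>Q\<close>, and
  these agree by induction.\<close>

lemma equilibrium_Q_info:
  fixes G :: "('i::finite, 'x::finite, 'u::finite, 'y::finite, 'w::finite, 'h::finite) game"
  assumes bm: "belief_map G \<iota>1 \<iota> i \<Phi>" and rat: "seq_rational G g Q"
    and mixed: "\<And>m. fully_mixed G (gs m)"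
    and lim: "\<And>t h u. t \<in> {1..horizon G} \<Longrightarrow> h \<in> hists G i t \<Longrightarrow> u \<in> acts G i t \<Longrightarrow>
       (\<lambda>m. pmf (gs m i t h) u) \<longlonglongrightarrow> pmf (g i t h) u"
    and limQ: "\<And>t h u. t \<in> {1..horizon G} \<Longrightarrow> h \<in> hists G i t \<Longrightarrow> u \<in> acts G i t \<Longrightarrow>
       (\<lambda>m. Qval G (gs m) i t h u) \<longlonglongrightarrow> Q i t h u"
    and "n < horizon G" "h \<in> hists G i (Suc n)" "h' \<in> hists G i (Suc n)"
    "reachable G (gs 0) i n h" "reachable G (gs 0) i n h'"
    "compress \<iota>1 \<iota> i (Suc n) h = compress \<iota>1 \<iota> i (Suc n) h'" "a \<in> acts G i (Suc n)"
  shows "Q i (Suc n) h a = Q i (Suc n) h' a"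
  using assms(6-)
proof (induction "horizon G - n" arbitrary: n h h' a rule: less_induct)
  case less
  note n = less.prems(1)
  have "(\<lambda>m. Qval G (gs m) i (Suc n) h a - Qval G (gs m) i (Suc n) h' a) \<longlonglongrightarrow> 0"
  \<comment> \<open>Both sequences are \<open>gs\<close>; only the histories differ.\<close>
  proof (rule Qval_diff_tendsto[OF bm n mixed mixed])
    fix b
    let ?h = "extend h (a, b)" and ?h' = "extend h' (a, b)"
    assume T: "Suc n < horizon G" and reach: "reachable G (gs 0) i (Suc n) ?h" "reachable G (gs 0) i (Suc n) ?h'"
    have hist: "?h \<in> hists G i (Suc (Suc n))" "?h' \<in> hists G i (Suc (Suc n))"
      using less.prems by (simp_all add: extend_hists)
    have len: "length (snd h) = n" "length (snd h') = n"
      using less.prems by (auto simp: hists_def)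
    have "compress \<iota>1 \<iota> i (Suc (Suc n)) ?h = compress \<iota>1 \<iota> i (Suc (Suc n)) ?h'"
      using less.prems by (simp add: compress_extend len)
    then have Q: "Q i (Suc (Suc n)) ?h a' = Q i (Suc (Suc n)) ?h' a'" if "a' \<in> acts G i (Suc (Suc n))" for a'
      using less.hyps[of "Suc n" ?h ?h' a'] n T hist reach that by linarith
    have V: "(\<lambda>m. cont_value G (gs m) i (Suc n) z) \<longlonglongrightarrow> Max (Q i (Suc (Suc n)) z ` acts G i (Suc (Suc n)))"
      if "z \<in> hists G i (Suc (Suc n))" for z
      unfolding cont_value_def
    proof (rule tendsto_value)
      show "set_pmf (gs m i (Suc (Suc n)) z) \<subseteq> acts G i (Suc (Suc n))" for m
        using fully_mixedD[OF mixed T that] by simp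
      show "set_pmf (g i (Suc (Suc n)) z) \<subseteq> {a \<in> acts G i (Suc (Suc n)).
          \<forall>b\<in>acts G i (Suc (Suc n)). Q i (Suc (Suc n)) z b \<le> Q i (Suc (Suc n)) z a}"
        using rat T that by (simp add: seq_rational_def)
    qed (use lim limQ T that in auto)
    have "Q i (Suc (Suc n)) ?h ` acts G i (Suc (Suc n)) = Q i (Suc (Suc n)) ?h' ` acts G i (Suc (Suc n))"
      by (intro image_cong refl Q)
    then show "(\<lambda>m. cont_value G (gs m) i (Suc n) ?h - cont_value G (gs m) i (Suc n) ?h') \<longlonglongrightarrow> 0"
      using tendsto_diff[OF V[OF hist(1)] V[OF hist(2)]] by simp
  qed (use less.prems in auto)
  moreover have "(\<lambda>m. Qval G (gs m) i (Suc n) h a - Qval G (gs m) i (Suc n) h' a)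
      \<longlonglongrightarrow> Q i (Suc n) h a - Q i (Suc n) h' a"
    using less.prems by (intro tendsto_diff limQ) auto
  ultimately show ?case using LIMSEQ_unique by fastforce
qed

subsection \<open>Compressing the players one by one\<close>

lemma seq_eq_compress_player:
  fixes G :: "('i::finite, 'x::finite, 'u::finite, 'y::finite, 'w::finite, 'h::finite) game"
  assumes wf: "game_wf G" and usi: "USI G \<iota>1 \<iota> i" and eq: "seq_eq G g Q"
  shows "\<exists>\<rho>. seq_eq G (g(i := \<lambda>t h. \<rho> t (compress \<iota>1 \<iota> i t h))) Q \<and>
    (\<forall>j. payoff G (g(i := \<lambda>t h. \<rho> t (compress \<iota>1 \<iota> i t h))) j = payoff G g j)"
proof -
  let ?T = "horizon G" and ?c = "compress \<iota>1 \<iota> i"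
  obtain \<Phi> where bm: "belief_map G \<iota>1 \<iota> i \<Phi>" using USI_belief_map[OF usi] .
  have beh: "behavioral G g" and rat: "seq_rational G g Q" using eq by (auto simp: seq_eq_def)
  obtain gs0 where gs0: "\<And>m. fully_mixed G (gs0 m)"
    "\<And>j t h u. t \<in> {1..?T} \<Longrightarrow> h \<in> hists G j t \<Longrightarrow> u \<in> acts G j t \<Longrightarrow>
       (\<lambda>m. pmf (gs0 m j t h) u) \<longlonglongrightarrow> pmf (g j t h) u"
    "\<And>j t h u. t \<in> {1..?T} \<Longrightarrow> h \<in> hists G j t \<Longrightarrow> u \<in> acts G j t \<Longrightarrow>
       (\<lambda>m. Qval G (gs0 m) j t h u) \<longlonglongrightarrow> Q j t h u"
    using eq unfolding seq_eq_def fully_consistent_def by blast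
  \<comment> \<open>The type \<open>'k\<close> may be infinite, but only the finitely many values
    attained at histories of the game need a limit.\<close>
  define I where "I = (SIGMA t:{1..?T}. ?c t ` hists G i t)"
  have "finite I" unfolding I_def by (intro finite_SigmaI finite_imageI finite_hists) simp
  \<comment> \<open>\<open>mean_act\<close> counts times from 0, hence the argument
    \<open>fst tk - 1\<close>.\<close>
  then obtain r \<rho> where r: "strict_mono r" and \<rho>0: "\<forall>tk\<in>I. \<forall>a.
      (\<lambda>m. pmf (mean_act G \<iota>1 \<iota> i (gs0 (r m)) (fst tk - 1) (snd tk)) a) \<longlonglongrightarrow> pmf (\<rho> tk) a"
    using pmf_convergent_subsequence_finite[of I "\<lambda>m tk. mean_act G \<iota>1 \<iota> i (gs0 m) (fst tk - 1) (snd tk)"]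
    by blast
  \<comment> \<open>The subsequence \<open>gs\<close> still approximates \<open>(g, Q)\<close>, and
    its averages \<open>gt\<close> will witness consistency of the limit profile
    \<open>g'\<close>.\<close>
  define gs where "gs m = gs0 (r m)" for m
  define gt where "gt m = mean_profile G \<iota>1 \<iota> i (gs m)" for m
  define g' where "g' = g(i := \<lambda>t h. \<rho> (t, ?c t h))"
  have mixed: "fully_mixed G (gs m)" for m by (simp add: gs_def gs0)
  have mixed': "fully_mixed G (gt m)" for m unfolding gt_def by (rule fully_mixed_mean_profile[OF wf mixed])
  have beh_gs: "behavioral G (gs m)" "behavioral G (gt m)" for m
    using mixed mixed' by (auto intro: fully_mixed_imp_behavioral)
  have lim: "(\<lambda>m. pmf (gs m j t h) u) \<longlonglongrightarrow> pmf (g j t h) u"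
    and limQ: "(\<lambda>m. Qval G (gs m) j t h u) \<longlonglongrightarrow> Q j t h u"
    if "t \<in> {1..?T}" "h \<in> hists G j t" "u \<in> acts G j t" for j t h u
    using LIMSEQ_subseq_LIMSEQ[OF gs0(2)[OF that] r] LIMSEQ_subseq_LIMSEQ[OF gs0(3)[OF that] r]
    by (simp_all add: gs_def o_def)
  have \<rho>: "(\<lambda>m. pmf (mean_act G \<iota>1 \<iota> i (gs m) n (?c (Suc n) h)) a) \<longlonglongrightarrow> pmf (\<rho> (Suc n, ?c (Suc n) h)) a"
    if "n < ?T" "h \<in> hists G i (Suc n)" for n h a
  proof -
    have "(Suc n, ?c (Suc n) h) \<in> I" using that by (auto simp: I_def)
    then show ?thesis using \<rho>0 by (fastforce simp: gs_def)
  qed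
  have gt_other: "gt m j = gs m j" if "j \<noteq> i" for m j
    using that by (simp add: gt_def mean_profile_def)
  have gt_i: "gt m i (Suc n) h = mean_act G \<iota>1 \<iota> i (gs m) n (?c (Suc n) h)" for m n h
    by (simp add: gt_def mean_profile_def)
  have lim': "(\<lambda>m. pmf (gt m j t h) u) \<longlonglongrightarrow> pmf (g' j t h) u"
    if t: "t \<in> {1..?T}" "h \<in> hists G j t" "u \<in> acts G j t" for j t h u
  proof (cases "j = i")
    case True
    obtain n where "t = Suc n" "n < ?T" using t(1) by (cases t) auto
    then show ?thesis using \<rho>[of n h u] t(2) True by (simp add: g'_def gt_i)
  next
    case False
    then show ?thesis using lim[OF t] by (simp add: gt_other g'_def)
  qed
  have \<rho>_acts: "set_pmf (\<rho> (Suc n, ?c (Suc n) h)) \<subseteq> acts G i (Suc n)" if n: "n < ?T" and h: "h \<in> hists G i (Suc n)" for n h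
  proof
    fix a assume a: "a \<in> set_pmf (\<rho> (Suc n, ?c (Suc n) h))"
    show "a \<in> acts G i (Suc n)"
    proof (rule ccontr)
      assume "a \<notin> acts G i (Suc n)"
      then have "pmf (gt m i (Suc n) h) a = 0" for m
        using fully_mixedD[OF mixed' n h] by (simp add: pmf_eq_0_set_pmf)
      then have "pmf (\<rho> (Suc n, ?c (Suc n) h)) a = 0"
        using \<rho>[OF n h, of a] by (simp add: gt_i LIMSEQ_const_iff)
      then show False using a by (simp add: set_pmf_iff)
    qed
  qed
  have beh': "behavioral G g'"
    unfolding behavioral_def
  proof (intro allI ballI)
    fix j t h assume t: "t \<in> {1..?T}" "h \<in> hists G j t"
    then obtain n where n: "t = Suc n" "n < ?T" by (cases t) auto
    show "set_pmf (g' j t h) \<subseteq> acts G j t"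
      using t \<rho>_acts[OF n(2), of h] beh by (auto simp: g'_def n behavioral_def)
  qed
  \<comment> \<open>\<open>gt m\<close> and \<open>gs m\<close> have identical payoffs, so one
    sequence converges to both sides.\<close>
  have pay: "payoff G g' j = payoff G g j" for j
  proof -
    have "(\<lambda>m. payoff G (gt m) j) \<longlonglongrightarrow> payoff G g' j"
      by (rule payoff_tendsto[OF beh_gs(2) beh' lim'])
    moreover have "(\<lambda>m. payoff G (gt m) j) \<longlonglongrightarrow> payoff G g j"
      unfolding gt_def payoff_mean_profile[OF bm beh_gs(1)] by (rule payoff_tendsto[OF beh_gs(1) beh lim])
    ultimately show ?thesis by (rule LIMSEQ_unique)
  qed
  have opt: "set_pmf (\<rho> (Suc n, ?c (Suc n) h)) \<subseteq>
      {a \<in> acts G i (Suc n). \<forall>b\<in>acts G i (Suc n). Q i (Suc n) h b \<le> Q i (Suc n) h a}"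
    if n: "n < ?T" and h: "h \<in> hists G i (Suc n)" for n h
  proof (cases "reachable G (gs 0) i n h")
    case True
    show ?thesis
    proof
      fix a assume a: "a \<in> set_pmf (\<rho> (Suc n, ?c (Suc n) h))"
      then have a_act: "a \<in> acts G i (Suc n)" using \<rho>_acts[OF n h] by blast
      let ?A = "{h' \<in> hists G i (Suc n). reachable G (gs 0) i n h' \<and> ?c (Suc n) h' = ?c (Suc n) h}"
      have "\<not> (\<forall>h'\<in>?A. a \<notin> set_pmf (g i (Suc n) h'))"
      proof
        assume none: "\<forall>h'\<in>?A. a \<notin> set_pmf (g i (Suc n) h')"
        have reach: "reachable G (gs m) i n h' = reachable G (gs 0) i n h'" for m h'
          by (rule reachable_fully_mixed[OF mixed mixed]) (use n in simp)
        have "(\<lambda>m. \<Sum>h'\<in>?A. pmf (gs m i (Suc n) h') a) \<longlonglongrightarrow> (\<Sum>h'\<in>?A. pmf (g i (Suc n) h') a)"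
          using n a_act by (intro tendsto_sum lim) auto
        moreover have "(\<Sum>h'\<in>?A. pmf (g i (Suc n) h') a) = 0"
          using none by (intro sum.neutral) (auto simp: set_pmf_iff)
        ultimately have "(\<lambda>m. \<Sum>h'\<in>?A. pmf (gs m i (Suc n) h') a) \<longlonglongrightarrow> 0" by (simp only:)
        moreover have "pmf (mean_act G \<iota>1 \<iota> i (gs m) n (?c (Suc n) h)) a \<le> (\<Sum>h'\<in>?A. pmf (gs m i (Suc n) h') a)" for m
        proof -
          have "{h' \<in> hists G i (Suc n). reachable G (gs m) i n h' \<and> ?c (Suc n) h' = ?c (Suc n) h} = ?A"
            using reach[of m] by blast
          moreover have "reachable G (gs m) i n h" using True reach[of m h] by (rule iffD2[rotated])
          ultimately show ?thesis
            using pmf_mean_act_le[OF beh_gs(1) n _ refl, of m i h \<iota>1 \<iota> a] by (simp only:)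
        qed
        ultimately have "pmf (\<rho> (Suc n, ?c (Suc n) h)) a \<le> 0"
          using LIMSEQ_le[OF \<rho>[OF n h, of a]] by blast
        then show False using a by (simp add: set_pmf_iff)
      qed
      then obtain h' where h': "h' \<in> hists G i (Suc n)" "reachable G (gs 0) i n h'" "?c (Suc n) h' = ?c (Suc n) h"
        and a': "a \<in> set_pmf (g i (Suc n) h')" by blast
      have "set_pmf (g i (Suc n) h') \<subseteq> {a \<in> acts G i (Suc n). \<forall>b\<in>acts G i (Suc n). Q i (Suc n) h' b \<le> Q i (Suc n) h' a}"
        using rat n h'(1) by (simp add: seq_rational_def)
      \<comment> \<open>Optimality of \<open>a\<close> at \<open>h'\<close> moves to
        \<open>h\<close>, since equal compressions carry equal values.\<close>
      moreover have "Q i (Suc n) h' b = Q i (Suc n) h b" if "b \<in> acts G i (Suc n)" for b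
        by (rule equilibrium_Q_info[OF bm rat mixed lim limQ n h'(1) h h'(2) True h'(3) that])
      ultimately show "a \<in> {a \<in> acts G i (Suc n). \<forall>b\<in>acts G i (Suc n). Q i (Suc n) h b \<le> Q i (Suc n) h a}"
        using a' a_act by auto
    qed
  next
    case False
    have "Q i (Suc n) h a = 0" if "a \<in> acts G i (Suc n)" for a
    proof -
      have "measure_pmf.prob (mrun G (gs m) n) {s. snd s i = h} = 0" for m
        using False reachable_fully_mixed[OF mixed mixed, of n m i h 0] n
        by (simp add: reachable_def zero_less_measure_iff)
      then have "Qval G (gs m) i (Suc n) h a = 0" for m by (rule Qval_unreached[OF n])
      then show ?thesis using limQ[of "Suc n" h i a] n h that by (simp add: LIMSEQ_const_iff)
    qed
    then show ?thesis using \<rho>_acts[OF n h] by auto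
  qed
  have rat': "seq_rational G g' Q"
    unfolding seq_rational_def
  proof (intro allI ballI)
    fix j t h assume t: "t \<in> {1..?T}" "h \<in> hists G j t"
    then obtain n where n: "t = Suc n" "n < ?T" by (cases t) auto
    show "set_pmf (g' j t h) \<subseteq> {u \<in> acts G j t. \<forall>u'\<in>acts G j t. Q j t h u' \<le> Q j t h u}"
    proof (cases "j = i")
      case True
      then show ?thesis using opt[OF n(2), of h] t by (simp add: g'_def n)
    next
      case False
      then show ?thesis using rat t by (simp add: g'_def seq_rational_def)
    qed
  qed
  \<comment> \<open>Backward induction: \<open>\<rho>\<close> and \<open>g\<close> are both
    supported on maximizers of \<open>Q\<close>, so the continuation values of \<open>gt\<close> and
    \<open>gs\<close> tend to the same maximum \<open>?M\<close>.\<close>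
  have own: "(\<lambda>m. Qval G (gt m) i (Suc n) h a) \<longlonglongrightarrow> Q i (Suc n) h a"
    if "n < ?T" "h \<in> hists G i (Suc n)" "a \<in> acts G i (Suc n)" for n h a
    using that
  proof (induction "?T - n" arbitrary: n h a rule: less_induct)
    case less
    note n = less.prems(1) and h = less.prems(2) and a = less.prems(3)
    have limQ': "(\<lambda>m. Qval G (gs m) i (Suc n) h a) \<longlonglongrightarrow> Q i (Suc n) h a" using less.prems by (intro limQ) auto
    show ?case
    proof (cases "reachable G (gt 0) i n h")
      case False
      have "measure_pmf.prob (mrun G (gt m) n) {s. snd s i = h} = 0"
        "measure_pmf.prob (mrun G (gs m) n) {s. snd s i = h} = 0" for m
        using False reachable_fully_mixed[OF mixed' mixed', of n m i h 0]
          reachable_fully_mixed[OF mixed mixed', of n m i h 0] n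
        by (simp_all add: reachable_def zero_less_measure_iff)
      then have "Qval G (gt m) i (Suc n) h a = Qval G (gs m) i (Suc n) h a" for m
        by (simp add: Qval_unreached[OF n])
      then show ?thesis using limQ' by simp
    next
      case True
      have "(\<lambda>m. Qval G (gt m) i (Suc n) h a - Qval G (gs m) i (Suc n) h a) \<longlonglongrightarrow> 0"
      \<comment> \<open>Here the history is the same on both sides and the two sequences differ in
        the strategy of player \<open>i\<close>.\<close>
      proof (rule Qval_diff_tendsto[where g=gt and g'=gs and h=h and h'=h, OF bm n mixed' mixed gt_other h h True True refl a])
        fix b
        let ?h = "extend h (a, b)"
        assume T: "Suc n < ?T"
        have h1: "?h \<in> hists G i (Suc (Suc n))" using h a by (simp add: extend_hists)
        let ?M = "Max (Q i (Suc (Suc n)) ?h ` acts G i (Suc (Suc n)))"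
        have "(\<lambda>m. cont_value G (gt m) i (Suc n) ?h) \<longlonglongrightarrow> ?M"
          unfolding cont_value_def
        proof (rule tendsto_value)
          show "set_pmf (gt m i (Suc (Suc n)) ?h) \<subseteq> acts G i (Suc (Suc n))" for m
            using fully_mixedD[OF mixed' T h1] by simp
          show "set_pmf (\<rho> (Suc (Suc n), ?c (Suc (Suc n)) ?h)) \<subseteq> {a \<in> acts G i (Suc (Suc n)).
              \<forall>b\<in>acts G i (Suc (Suc n)). Q i (Suc (Suc n)) ?h b \<le> Q i (Suc (Suc n)) ?h a}"
            by (rule opt[OF T h1])
          show "(\<lambda>m. pmf (gt m i (Suc (Suc n)) ?h) a) \<longlonglongrightarrow> pmf (\<rho> (Suc (Suc n), ?c (Suc (Suc n)) ?h)) a" for a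
            unfolding gt_i by (rule \<rho>[OF T h1])
          show "(\<lambda>m. Qval G (gt m) i (Suc (Suc n)) ?h a) \<longlonglongrightarrow> Q i (Suc (Suc n)) ?h a"
            if "a \<in> acts G i (Suc (Suc n))" for a
            using less.hyps[of "Suc n" ?h a] T h1 that by simp
        qed
        moreover have "(\<lambda>m. cont_value G (gs m) i (Suc n) ?h) \<longlonglongrightarrow> ?M"
          unfolding cont_value_def
        proof (rule tendsto_value)
          show "set_pmf (gs m i (Suc (Suc n)) ?h) \<subseteq> acts G i (Suc (Suc n))" for m
            using fully_mixedD[OF mixed T h1] by simp
          show "set_pmf (g i (Suc (Suc n)) ?h) \<subseteq> {a \<in> acts G i (Suc (Suc n)).
              \<forall>b\<in>acts G i (Suc (Suc n)). Q i (Suc (Suc n)) ?h b \<le> Q i (Suc (Suc n)) ?h a}"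
            using rat T h1 by (simp add: seq_rational_def)
        qed (use lim limQ T h1 in auto)
        ultimately show "(\<lambda>m. cont_value G (gt m) i (Suc n) ?h - cont_value G (gs m) i (Suc n) ?h) \<longlonglongrightarrow> 0"
          using tendsto_diff[of _ ?M _ _ ?M] by fastforce
      qed
      then show ?thesis using tendsto_add[OF _ limQ'] by fastforce
    qed
  qed
  have "fully_consistent G g' Q"
    unfolding fully_consistent_def
  proof (intro exI[of _ gt] conjI allI ballI)
    fix j t h u assume t: "t \<in> {1..?T}" "h \<in> hists G j t" "u \<in> acts G j t"
    then obtain n where n: "t = Suc n" "n < ?T" by (cases t) auto
    show "(\<lambda>m. pmf (gt m j t h) u) \<longlonglongrightarrow> pmf (g' j t h) u" by (rule lim'[OF t])
    show "(\<lambda>m. Qval G (gt m) j t h u) \<longlonglongrightarrow> Q j t h u"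
    proof (cases "j = i")
      case True
      then show ?thesis using own[OF n(2), of h u] t n(1) by simp
    next
      case False
      \<comment> \<open>For the other players the action values agree for every \<open>m\<close>,
        before any limit is taken.\<close>
      then show ?thesis
        using limQ[OF t] by (simp add: n(1) gt_def Qval_mean_profile_other[OF bm beh_gs(1) n(2)])
    qed
  qed (use mixed' beh_gs in auto)
  then have "seq_eq G g' Q" using beh' rat' by (simp add: seq_eq_def)
  then show ?thesis
    using pay unfolding g'_def by (intro exI[of _ "\<lambda>t k. \<rho> (t, k)"]) simp
qed

text \<open>USI constrains the game under all behavioral profiles, so it is still available after
  earlier replacements; each step changes a single strategy and leaves the players already in
  \<open>S\<close> compressed.\<close>

lemma seq_eq_compress_players:
  fixes G :: "('i::finite, 'x::finite, 'u::finite, 'y::finite, 'w::finite, 'h::finite) game"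
  assumes wf: "game_wf G" and usi: "\<forall>i. USI G \<iota>1 \<iota> i" and eq: "seq_eq G g Q" and "finite S"
  shows "\<exists>\<rho>. seq_eq G (\<lambda>i. if i \<in> S then kbased \<iota>1 \<iota> \<rho> i else g i) Q \<and>
    (\<forall>j. payoff G (\<lambda>i. if i \<in> S then kbased \<iota>1 \<iota> \<rho> i else g i) j = payoff G g j)"
  using \<open>finite S\<close>
proof induction
  case empty
  then show ?case using eq by simp
next
  case (insert i S)
  then obtain \<rho> where \<rho>: "seq_eq G (\<lambda>i. if i \<in> S then kbased \<iota>1 \<iota> \<rho> i else g i) Q"
    "\<forall>j. payoff G (\<lambda>i. if i \<in> S then kbased \<iota>1 \<iota> \<rho> i else g i) j = payoff G g j" by blast
  let ?g = "\<lambda>i. if i \<in> S then kbased \<iota>1 \<iota> \<rho> i else g i"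
  obtain \<rho>i where \<rho>i: "seq_eq G (?g(i := \<lambda>t h. \<rho>i t (compress \<iota>1 \<iota> i t h))) Q"
    "\<forall>j. payoff G (?g(i := \<lambda>t h. \<rho>i t (compress \<iota>1 \<iota> i t h))) j = payoff G ?g j"
    using seq_eq_compress_player[OF wf usi[rule_format] \<rho>(1)] by blast
  have "?g(i := \<lambda>t h. \<rho>i t (compress \<iota>1 \<iota> i t h))
      = (\<lambda>j. if j \<in> insert i S then kbased \<iota>1 \<iota> (\<rho>(i := \<rho>i)) j else g j)"
    using insert.hyps by (auto simp: fun_eq_iff kbased_def)
  then show ?case using \<rho>i \<rho>(2) by (intro exI[of _ "\<rho>(i := \<rho>i)"]) (simp only: simp_thms)
qed

theorem theorem4:
  fixes G :: "('i::finite, 'x::finite, 'u::finite, 'y::finite, 'w::finite, 'h::finite) game"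
    and \<iota>1 :: "'i \<Rightarrow> 'h \<Rightarrow> 'k"
    and \<iota> :: "'i \<Rightarrow> nat \<Rightarrow> 'k \<Rightarrow> 'u \<times> 'y \<Rightarrow> 'k"
  assumes "game_wf G"
    and "\<forall>i. USI G \<iota>1 \<iota> i"
  shows "{(\<lambda>i. payoff G (kbased \<iota>1 \<iota> \<rho>) i) | \<rho> Q. seq_eq G (kbased \<iota>1 \<iota> \<rho>) Q}
       = {(\<lambda>i. payoff G g i) | g Q. seq_eq G g Q}"
proof (intro equalityI subsetI)
  fix J assume "J \<in> {(\<lambda>i. payoff G g i) | g Q. seq_eq G g Q}"
  then obtain g Q where J: "J = (\<lambda>i. payoff G g i)" and eq: "seq_eq G g Q" by blast
  \<comment> \<open>With all players in the treated set the resulting profile is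
    \<open>kbased\<close> outright.\<close>
  obtain \<rho> where \<rho>: "seq_eq G (kbased \<iota>1 \<iota> \<rho>) Q" "\<forall>j. payoff G (kbased \<iota>1 \<iota> \<rho>) j = payoff G g j"
    using seq_eq_compress_players[OF assms eq finite[of UNIV]] by auto
  have "J = (\<lambda>i. payoff G (kbased \<iota>1 \<iota> \<rho>) i)"
    using \<rho>(2) J by (simp add: fun_eq_iff)
  have "J = (\<lambda>i. payoff G (kbased \<iota>1 \<iota> \<rho>) i)"
    using \<rho>(2) J by (simp add: fun_eq_iff)
  then show "J \<in> {(\<lambda>i. payoff G (kbased \<iota>1 \<iota> \<rho>) i) | \<rho> Q. seq_eq G (kbased \<iota>1 \<iota> \<rho>) Q}"
    using \<rho>(1) by blast
\<comment> \<open>The remaining inclusion holds because a K-based equilibrium is in particular an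
  equilibrium.\<close>
qed blast

end
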